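(* Let $\mathcal{N}_8^2$ be the variety of at most 2-step nilpotent Lie algebra structures on an 8-dimensional complex vector space with fixed basis $x_1,\dots,x_8$, with its action of $\operatorname{GL}(8,\mathbb{C})$ by change of basis. Consider the following three elements of $\mathcal{N}_8^2$ (brackets $[x_i,x_j]$ not determined by those listed via skew-symmetry are zero): - $N_1^{8,2}$: $[x_1,x_2]=x_7$, $[x_3,x_4]=x_8$, $[x_5,x_6]=x_7+x_8$; - $N_9^{8,3}$: $[x_1,x_2]=x_6$, $[x_1,x_3]=x_7$, $[x_2,x_3]=x_8$, $[x_1,x_4]=x_8$, $[x_2,x_5]=x_7$, $[x_4,x_5]=x_6$; - $N_1^{8,4}$: $[x_1,x_2]=x_5$, $[x_2,x_3]=x_6$, $[x_3,x_4]=x_7$, $[x_4,x_1]=x_8$. Then the irreducible components of the variety $\mathcal{N}_8^2$ are the three Zariski orbit closures $$C_1=\overline{O(N_1^{8,2})},\qquad C_2=\overline{O(N_9^{8,3})},\qquad C_3=\overline{O(N_1^{8,4})}.$$ Moreover, the Lie algebras $N_1^{8,2}$, $N_9^{8,3}$ and $N_1^{8,4}$ are rigid in $\mathcal{N}_8^2$.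
   Context: Fix a complex $n$-dimensional vector space $V$ with a fixed basis (here $n=8$). A Lie algebra structure $\mathfrak{g}=(V,[\cdot,\cdot])$ on $V$ is identified with its structure constants $(c_{ij}^k)\in\mathbb{C}^{n^3}$ with respect to the fixed basis. The set $\mathcal{L}_n\subset\mathbb{C}^{n^3}$ of all Lie algebra structures is the algebraic variety cut out by the polynomial equations given by skew-symmetry and the Jacobi identity, and carries the Zariski topology. The variety $\mathcal{N}_n^2$ is the Zariski-closed subset of $\mathcal{L}_n$ consisting of those $\mathfrak{g}$ with $[\mathfrak{g},[\mathfrak{g},\mathfrak{g}]]=0$ (at most 2-step nilpotent Lie algebras). The group $\operatorname{GL}(n,\mathbb{C})$ acts on $\mathcal{L}_n$ (and preserves $\mathcal{N}_n^2$) by change of basis: $(g\cdot[\cdot,\cdot])(X,Y)=g\left([g^{-1}X,g^{-1}Y]\right)$. $O(\mathfrak{g})$ denotes the orbit of $\mathfrak{g}$ under this action and $\overline{O(\mathfrak{g})}$ its Zariski closure. A Lie algebra $\mathfrak{g}\in\mathcal{N}_n^2$ is called rigid in $\mathcal{N}_n^2$ if its orbit $O(\mathfrak{g})$ is open in $\mathcal{N}_n^2$ (Zariski topology). *)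

theory Defs
  imports "HOL-Analysis.Analysis"
begin

section \<open>Irreducible components of a topological space\<close>

definition irreducible_in :: "'a topology \<Rightarrow> 'a set \<Rightarrow> bool" where
  "irreducible_in X S \<longleftrightarrow> S \<subseteq> topspace X \<and> S \<noteq> {} \<and>
     (\<forall>A B. closedin X A \<longrightarrow> closedin X B \<longrightarrow> S \<subseteq> A \<union> B \<longrightarrow> S \<subseteq> A \<or> S \<subseteq> B)"

definition irreducible_components :: "'a topology \<Rightarrow> 'a set set" where
  "irreducible_components X =
     {S. irreducible_in X S \<and> (\<forall>T. irreducible_in X T \<longrightarrow> S \<subseteq> T \<longrightarrow> S = T)}"

section \<open>Structure constants and the Zariski topology\<close>

text \<open>The structure constant \<open>c\<^sub>i\<^sub>j\<^sup>k\<close> is \<open>c $ i $ j $ k\<close>.\<close>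

type_synonym 'n structure_constants = "complex ^ 'n ^ 'n ^ 'n"

text \<open>Polynomials in the coordinates enter only through their zero sets, so they are
  represented by the functions they define.\<close>

inductive polynomial_fun :: "('n::finite structure_constants \<Rightarrow> complex) \<Rightarrow> bool" where
  const: "polynomial_fun (\<lambda>c. a)"
| coordinate: "polynomial_fun (\<lambda>c. c $ i $ j $ k)"
| add: "polynomial_fun p \<Longrightarrow> polynomial_fun q \<Longrightarrow> polynomial_fun (\<lambda>c. p c + q c)"
| mult: "polynomial_fun p \<Longrightarrow> polynomial_fun q \<Longrightarrow> polynomial_fun (\<lambda>c. p c * q c)"

definition zero_locus :: "('n::finite structure_constants \<Rightarrow> complex) set
    \<Rightarrow> 'n structure_constants set" where
  "zero_locus P = {c. \<forall>p\<in>P. p c = 0}"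

definition algebraic_set :: "'n::finite structure_constants set \<Rightarrow> bool" where
  "algebraic_set A \<longleftrightarrow> (\<exists>P. (\<forall>p\<in>P. polynomial_fun p) \<and> A = zero_locus P)"

definition zariski :: "'n::finite structure_constants topology" where
  "zariski = topology (\<lambda>U. algebraic_set (- U))"

lemma algebraic_set_Un:
  assumes "algebraic_set A" "algebraic_set B"
  shows "algebraic_set (A \<union> B)"
proof -
  obtain P Q where P: "\<forall>p\<in>P. polynomial_fun p" "A = zero_locus P"
    and Q: "\<forall>q\<in>Q. polynomial_fun q" "B = zero_locus Q"
    using assms unfolding algebraic_set_def by auto
  let ?R = "{\<lambda>c. p c * q c | p q. p \<in> P \<and> q \<in> Q}"
  have "\<forall>r\<in>?R. polynomial_fun r"
    using P(1) Q(1) by (auto intro: polynomial_fun.mult)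
  moreover have "A \<union> B = zero_locus ?R"
  proof (intro equalityI subsetI)
    fix c assume "c \<in> A \<union> B"
    then show "c \<in> zero_locus ?R"
      unfolding P(2) Q(2) zero_locus_def by auto
  next
    fix c assume c: "c \<in> zero_locus ?R"
    have "p c = 0 \<or> q c = 0" if "p \<in> P" "q \<in> Q" for p q
    proof -
      have "\<forall>r\<in>?R. r c = 0"
        using c unfolding zero_locus_def by (rule CollectD)
      moreover have "(\<lambda>c. p c * q c) \<in> ?R"
        using that by blast
      ultimately have "p c * q c = 0"
        by (rule bspec)
      then show ?thesis
        by simp
    qed
    then have "(\<forall>p\<in>P. p c = 0) \<or> (\<forall>q\<in>Q. q c = 0)"
      by blast
    then show "c \<in> A \<union> B"
      unfolding P(2) Q(2) zero_locus_def by simp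
  qed
  ultimately show ?thesis
    unfolding algebraic_set_def by (intro exI conjI)
qed

lemma algebraic_set_Inter:
  assumes "\<And>A. A \<in> \<A> \<Longrightarrow> algebraic_set A"
  shows "algebraic_set (\<Inter>\<A>)"
proof -
  obtain P where P: "\<And>A. A \<in> \<A> \<Longrightarrow> (\<forall>p\<in>P A. polynomial_fun p) \<and> A = zero_locus (P A)"
    using assms unfolding algebraic_set_def by metis
  have "\<Inter>\<A> = (\<Inter>A\<in>\<A>. zero_locus (P A))"
    using P by simp
  also have "\<dots> = zero_locus (\<Union>A\<in>\<A>. P A)"
    unfolding zero_locus_def by auto
  finally have "\<Inter>\<A> = zero_locus (\<Union>A\<in>\<A>. P A)" .
  moreover have "\<forall>p\<in>(\<Union>A\<in>\<A>. P A). polynomial_fun p"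
    using P by simp
  ultimately show ?thesis
    unfolding algebraic_set_def by (intro exI conjI)
qed

lemma istopology_zariski: "istopology (\<lambda>U. algebraic_set (- U))"
  unfolding istopology_def
proof (intro conjI allI impI)
  fix S T :: "'a structure_constants set"
  assume "algebraic_set (- S)" "algebraic_set (- T)"
  then show "algebraic_set (- (S \<inter> T))"
    using algebraic_set_Un by (metis Compl_Int)
next
  fix \<K> :: "'a structure_constants set set"
  assume "\<forall>K\<in>\<K>. algebraic_set (- K)"
  then have "algebraic_set (\<Inter>(uminus ` \<K>))"
    by (intro algebraic_set_Inter) auto
  then show "algebraic_set (- \<Union>\<K>)"
    by (simp add: uminus_Sup)
qed

lemma openin_zariski: "openin zariski U \<longleftrightarrow> algebraic_set (- U)"
  unfolding zariski_def by (simp add: topology_inverse' istopology_zariski)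

lemma topspace_zariski [simp]: "topspace zariski = UNIV"
proof -
  have "algebraic_set (- UNIV :: 'a structure_constants set)"
    unfolding algebraic_set_def zero_locus_def
    by (rule exI[of _ "{\<lambda>c. 1}"]) (auto intro: polynomial_fun.const)
  then have "openin zariski (UNIV :: 'a structure_constants set)"
    by (simp only: openin_zariski)
  then show ?thesis
    by (simp add: openin_subset top.extremum_uniqueI)
qed

lemma closedin_zariski: "closedin zariski A \<longleftrightarrow> algebraic_set A"
  by (simp add: closedin_def openin_zariski Compl_eq_Diff_UNIV[symmetric])

section \<open>Lie algebra structures\<close>

definition bracket :: "'n::finite structure_constants \<Rightarrow> complex ^ 'n \<Rightarrow> complex ^ 'n \<Rightarrow> complex ^ 'n"
  where "bracket c X Y = (\<chi> k. \<Sum>i\<in>UNIV. \<Sum>j\<in>UNIV. X $ i * Y $ j * c $ i $ j $ k)"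

definition lie_structures :: "'n::finite structure_constants set" where
  "lie_structures = {c.
     (\<forall>X Y. bracket c X Y = - bracket c Y X) \<and>
     (\<forall>X Y Z. bracket c X (bracket c Y Z) + bracket c Y (bracket c Z X)
              + bracket c Z (bracket c X Y) = 0)}"

text \<open>\<open>bracket_space c A B\<close> is \<open>[A, B]\<close>, the complex span of all \<open>[X, Y]\<close> with
  \<open>X \<in> A\<close> and \<open>Y \<in> B\<close>.\<close>

definition bracket_space :: "'n::finite structure_constants \<Rightarrow> (complex ^ 'n) set
    \<Rightarrow> (complex ^ 'n) set \<Rightarrow> (complex ^ 'n) set" where
  "bracket_space c A B = vec.span {bracket c X Y | X Y. X \<in> A \<and> Y \<in> B}"

definition two_step_nilpotent :: "'n::finite structure_constants set" where
  "two_step_nilpotent =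
     {c \<in> lie_structures. bracket_space c UNIV (bracket_space c UNIV UNIV) = {0}}"

section \<open>Change of basis, orbits and rigidity\<close>

definition constants_of :: "(complex ^ 'n \<Rightarrow> complex ^ 'n \<Rightarrow> complex ^ 'n)
    \<Rightarrow> 'n::finite structure_constants" where
  "constants_of b = (\<chi> i j. b (axis i 1) (axis j 1))"

definition change_basis :: "complex ^ 'n ^ 'n \<Rightarrow> 'n::finite structure_constants
    \<Rightarrow> 'n structure_constants" where
  "change_basis g c =
     constants_of (\<lambda>X Y. g *v bracket c (matrix_inv g *v X) (matrix_inv g *v Y))"

definition orbit :: "'n::finite structure_constants \<Rightarrow> 'n structure_constants set" where
  "orbit c = {change_basis g c | g. invertible g}"

definition rigid_in :: "'n::finite structure_constants set \<Rightarrow> 'n structure_constants \<Rightarrow> bool" where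
  "rigid_in N c \<longleftrightarrow> c \<in> N \<and> openin (subtopology zariski N) (orbit c)"

section \<open>Structures given by a list of brackets\<close>

definition basis_vec :: "'n::finite \<Rightarrow> complex ^ 'n" where
  "basis_vec i = axis i 1"

text \<open>The fixed basis \<open>x\<^sub>1, \<dots>, x\<^sub>n\<close> is the standard one, \<open>x\<^sub>i = basis_vec i\<close>.
  An entry \<open>(i, j, v)\<close> stands for \<open>[x\<^sub>i, x\<^sub>j] = v\<close>, hence also \<open>[x\<^sub>j, x\<^sub>i] = - v\<close>; all
  brackets of basis vectors not determined in this way are zero.  In every list below each
  unordered pair of indices occurs at most once.\<close>

definition from_brackets :: "('n \<times> 'n \<times> (complex ^ 'n)) list \<Rightarrow> 'n::finite structure_constants" where
  "from_brackets L = (\<chi> p q. \<Sum>(i, j, v)\<leftarrow>L.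
     if p = i \<and> q = j then v else if p = j \<and> q = i then - v else 0)"

text \<open>The index type \<open>8\<close> of \<^theory>\<open>HOL-Library.Numeral_Type\<close> consists of the integers modulo 8,
  so \<open>1, \<dots>, 8\<close> are its eight distinct elements, with \<open>8 = 0\<close>.\<close>

definition N1_8_2 :: "8 structure_constants" where
  "N1_8_2 = from_brackets
     [(1, 2, basis_vec 7),
      (3, 4, basis_vec 8),
      (5, 6, basis_vec 7 + basis_vec 8)]"

definition N9_8_3 :: "8 structure_constants" where
  "N9_8_3 = from_brackets
     [(1, 2, basis_vec 6),
      (1, 3, basis_vec 7),
      (2, 3, basis_vec 8),
      (1, 4, basis_vec 8),
      (2, 5, basis_vec 7),
      (4, 5, basis_vec 6)]"

definition N1_8_4 :: "8 structure_constants" where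
  "N1_8_4 = from_brackets
     [(1, 2, basis_vec 5),
      (2, 3, basis_vec 6),
      (3, 4, basis_vec 7),
      (4, 1, basis_vec 8)]"

end

theory Submission
  imports Defs
begin

text \<open>A structure \<open>c\<close> in \<open>\<N>\<close> satisfies \<open>[\<gg>, \<gg>] \<subseteq> Z(\<gg>)\<close>. Since a skew form on an odd-dimensional
  space is degenerate, and since three generators have only three brackets, some \<open>k \<in> {2, 3, 4}\<close>
  lies between the dimensions of \<open>[\<gg>, \<gg>]\<close> and \<open>Z(\<gg>)\<close>. Hence \<open>c\<close> is conjugate to a point of the
  linear space \<open>\<Lambda>\<^sup>2(\<complex>\<^bsup>8-k\<^esup>)* \<otimes> \<complex>\<^sup>k\<close> on which \<open>GL(8 - k) \<times> GL(k)\<close> acts. At each of the three given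
  structures the infinitesimal action is onto. It remains onto outside a complex hypersurface,
  whose complement is connected, and there orbits are open; so the complement lies in a single
  orbit, which is dense. Density makes every \<open>c\<close> lie in one of the three orbit closures, and orbits
  of a connected group have irreducible closures. Near the given structure \<open>[\<gg>, \<gg>]\<close> and \<open>Z(\<gg>)\<close> both
  have dimension \<open>k\<close>, and a basis adapted to them can be chosen polynomially in \<open>c\<close>; this makes the
  orbit open in \<open>\<N>\<close>. An open orbit in the closure of another orbit coincides with it, but the
  dimensions of \<open>[\<gg>, \<gg>]\<close> are \<open>2\<close>, \<open>3\<close>, \<open>4\<close>, so no closure contains another one.\<close>

section \<open>Bilinearity of the bracket and the action of the general linear group\<close>

lemma bracket_nth: "bracket c X Y $ k = (\<Sum>i\<in>UNIV. \<Sum>j\<in>UNIV. X $ i * Y $ j * c $ i $ j $ k)"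
  by (simp add: bracket_def)

lemma bracket_add_left: "bracket c (X + X') Y = bracket c X Y + bracket c X' Y"
  by (simp add: vec_eq_iff bracket_nth distrib_right sum.distrib)

lemma bracket_add_right: "bracket c X (Y + Y') = bracket c X Y + bracket c X Y'"
  by (simp add: vec_eq_iff bracket_nth algebra_simps sum.distrib)

lemma bracket_scale_left: "bracket c (a *s X) Y = a *s bracket c X Y"
  by (simp add: vec_eq_iff bracket_nth sum_distrib_left mult_ac)

lemma bracket_scale_right: "bracket c X (a *s Y) = a *s bracket c X Y"
  by (simp add: vec_eq_iff bracket_nth sum_distrib_left mult_ac)

lemma vec_linearI:
  fixes f :: "complex ^ 'm \<Rightarrow> complex ^ 'n"
  assumes "\<And>X Y. f (X + Y) = f X + f Y" "\<And>a X. f (a *s X) = a *s f X"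
  shows "Vector_Spaces.linear (*s) (*s) f"
  by (simp add: Vector_Spaces.linear_iff assms vec.vector_space_axioms)

lemma linear_bracket_left: "Vector_Spaces.linear (*s) (*s) (\<lambda>X. bracket c X Y)"
  by (rule vec_linearI) (simp_all add: bracket_add_left bracket_scale_left)

lemma linear_bracket_right: "Vector_Spaces.linear (*s) (*s) (bracket c X)"
  by (rule vec_linearI) (simp_all add: bracket_add_right bracket_scale_right)

lemma bracket_zero_left [simp]: "bracket c 0 Y = 0"
  by (simp add: vec_eq_iff bracket_nth)

lemma bracket_zero_right [simp]: "bracket c X 0 = 0"
  by (simp add: vec_eq_iff bracket_nth)

lemma bracket_axis: "bracket c (axis i 1) (axis j 1) = c $ i $ j"
proof -
  have "axis i 1 $ p * axis j 1 $ q * c $ p $ q $ k =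
      (if q = j then if p = i then c $ i $ j $ k else 0 else 0)" for p q k
    by (simp add: axis_def)
  then show ?thesis
    by (simp add: vec_eq_iff bracket_nth)
qed

lemma vec_eq_sum_axis: "(X :: complex ^ 'n::finite) = (\<Sum>i\<in>UNIV. X $ i *s axis i 1)"
  by (simp add: basis_expansion)

lemma bilinear_expansion:
  fixes b :: "complex ^ 'n \<Rightarrow> complex ^ 'n \<Rightarrow> complex ^ 'm"
  assumes l: "\<And>Y. Vector_Spaces.linear (*s) (*s) (\<lambda>X. b X Y)"
    and r: "\<And>X. Vector_Spaces.linear (*s) (*s) (b X)"
  shows "b X Y = (\<Sum>i\<in>UNIV. \<Sum>j\<in>UNIV. (X $ i * Y $ j) *s b (axis i 1) (axis j 1))"
proof -
  have "b (\<Sum>i\<in>UNIV. X $ i *s axis i 1) Y = (\<Sum>i\<in>UNIV. X $ i *s b (axis i 1) Y)"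
    by (simp only: vec.linear_sum[OF l] vec.linear_scale[OF l])
  moreover have "b (axis i 1) (\<Sum>j\<in>UNIV. Y $ j *s axis j 1) =
      (\<Sum>j\<in>UNIV. Y $ j *s b (axis i 1) (axis j 1))" for i
    by (simp only: vec.linear_sum[OF r] vec.linear_scale[OF r])
  ultimately show ?thesis
    by (simp only: basis_expansion vec.scale_sum_right vec.scale_scale)
qed

text \<open>A bilinear map is determined by its values on pairs of basis vectors. This turns
  \<open>change_basis\<close>, defined by structure constants, into a formula for brackets of
  arbitrary vectors.\<close>

lemma bracket_constants_of:
  assumes "\<And>Y. Vector_Spaces.linear (*s) (*s) (\<lambda>X. b X Y)"
    and "\<And>X. Vector_Spaces.linear (*s) (*s) (b X)"
  shows "bracket (constants_of b) X Y = b X Y"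
  by (subst bilinear_expansion[of b, OF assms])
    (simp add: vec_eq_iff bracket_nth constants_of_def)

lemma structure_constants_eqI:
  assumes "\<And>X Y. bracket c X Y = bracket c' X Y"
  shows "c = c'"
  using assms[of "axis _ 1" "axis _ 1"] by (simp add: bracket_axis vec_eq_iff)

lemma matrix_inv_left_right:
  fixes g :: "complex ^ 'n ^ 'n"
  assumes "invertible g"
  shows "g ** matrix_inv g = mat 1" "matrix_inv g ** g = mat 1"
  using someI_ex[OF assms[unfolded invertible_def]] by (auto simp: matrix_inv_def)

lemma matrix_inv_mult_vector [simp]:
  fixes g :: "complex ^ 'n ^ 'n"
  assumes "invertible g"
  shows "g *v (matrix_inv g *v X) = X" "matrix_inv g *v (g *v X) = X"
  by (simp_all add: assms matrix_vector_mul_assoc matrix_inv_left_right)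

lemma invertible_matrix_inv:
  fixes g :: "complex ^ 'n ^ 'n"
  assumes "invertible g"
  shows "invertible (matrix_inv g)"
  using matrix_inv_left_right[OF assms] by (auto simp: invertible_def)

lemma matrix_inv_matrix_inv:
  fixes g :: "complex ^ 'n ^ 'n"
  assumes "invertible g"
  shows "matrix_inv (matrix_inv g) = g"
  by (metis assms invertible_matrix_inv matrix_inv_left_right matrix_mul_assoc
      matrix_mul_lid matrix_mul_rid)

lemma bracket_change_basis:
  "bracket (change_basis g c) X Y = g *v bracket c (matrix_inv g *v X) (matrix_inv g *v Y)"
  unfolding change_basis_def
  by (rule bracket_constants_of; rule vec_linearI)
    (simp_all add: matrix_vector_right_distrib bracket_add_left bracket_add_right
      vector_scalar_commute bracket_scale_left bracket_scale_right)

lemma matrix_vector_mult_axis: "(A *v axis i 1) $ a = (A $ a $ i :: complex)"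
  by (simp add: matrix_vector_mult_def axis_def if_distrib cong: if_cong)

text \<open>The entries are linear in \<open>c\<close> and polynomial in the entries of
  \<open>g\<close> and \<open>matrix_inv g\<close>. Both the Zariski continuity of the action and
  the clearing of denominators rest on this.\<close>

lemma change_basis_nth:
  "change_basis g c $ i $ j $ k = (\<Sum>p\<in>UNIV. g $ k $ p *
     (\<Sum>a\<in>UNIV. \<Sum>b\<in>UNIV. matrix_inv g $ a $ i * matrix_inv g $ b $ j * c $ a $ b $ p))"
proof -
  have "change_basis g c $ i $ j $ k = bracket (change_basis g c) (axis i 1) (axis j 1) $ k"
    by (simp add: bracket_axis)
  then show ?thesis
    by (simp add: bracket_change_basis matrix_vector_mult_def[of g] bracket_nth
        matrix_vector_mult_axis)
qed

lemma bracket_change_basis_image: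
  assumes "invertible g"
  shows "bracket (change_basis g c) (g *v X) (g *v Y) = g *v bracket c X Y"
  by (simp add: bracket_change_basis assms)

text \<open>Every vector has the form \<open>g *v X\<close>, so comparing brackets of such vectors
  suffices; this keeps inverse matrices out of later computations.\<close>

lemma change_basis_eqI:
  assumes "invertible g" and "\<And>X Y. bracket c' (g *v X) (g *v Y) = g *v bracket c X Y"
  shows "change_basis g c = c'"
  by (rule structure_constants_eqI)
    (simp add: bracket_change_basis assms(1) flip: assms(2))

lemma change_basis_change_basis:
  assumes "invertible g" "invertible h"
  shows "change_basis g (change_basis h c) = change_basis (g ** h) c"
  by (rule sym, rule change_basis_eqI)
    (simp_all add: assms invertible_mult bracket_change_basis_image flip: matrix_vector_mul_assoc)

lemma invertible_mat_1 [simp]: "invertible (mat 1 :: complex ^ 'n ^ 'n)"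
  by (auto simp: invertible_def intro: exI[of _ "mat 1"])

lemma change_basis_mat_1 [simp]: "change_basis (mat 1) c = c"
  by (rule change_basis_eqI) simp_all

lemma change_basis_matrix_inv:
  assumes "invertible g"
  shows "change_basis (matrix_inv g) (change_basis g c) = c"
    and "change_basis g (change_basis (matrix_inv g) c) = c"
  by (simp_all add: assms change_basis_change_basis invertible_matrix_inv matrix_inv_left_right)

lemma orbit_refl [simp]: "c \<in> orbit c"
  unfolding orbit_def by (rule CollectI) (metis change_basis_mat_1 invertible_mat_1)

lemma change_basis_in_orbit: "invertible g \<Longrightarrow> change_basis g c \<in> orbit c"
  by (auto simp: orbit_def)

lemma orbit_trans: "c \<in> orbit c' \<Longrightarrow> c' \<in> orbit c'' \<Longrightarrow> c \<in> orbit c''"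
  by (auto simp: orbit_def change_basis_change_basis) (metis invertible_mult)

lemma orbit_sym: "c \<in> orbit c' \<Longrightarrow> c' \<in> orbit c"
  by (auto simp: orbit_def) (metis change_basis_matrix_inv(1) invertible_matrix_inv)

lemma orbit_eqI: "c \<in> orbit c' \<Longrightarrow> orbit c = orbit c'"
  by (meson orbit_sym orbit_trans subsetI subset_antisym)

section \<open>Two-step nilpotent structures\<close>

text \<open>Once all iterated brackets vanish, each term of the Jacobi identity is zero, so
  skew-symmetry is all that remains of the Lie algebra axioms.\<close>

lemma two_step_nilpotent_iff_bracket:
  "c \<in> two_step_nilpotent \<longleftrightarrow>
     (\<forall>X Y. bracket c X Y = - bracket c Y X) \<and> (\<forall>X Y Z. bracket c X (bracket c Y Z) = 0)"
proof -
  have "bracket_space c UNIV (bracket_space c UNIV UNIV) = {0} \<longleftrightarrow>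
      (\<forall>X Y Z. bracket c X (bracket c Y Z) = 0)" (is "?L \<longleftrightarrow> ?R")
  proof
    assume L: ?L
    show ?R
    proof (intro allI)
      fix X Y Z
      have "bracket c Y Z \<in> bracket_space c UNIV UNIV"
        unfolding bracket_space_def by (rule vec.span_base) blast
      then have "bracket c X (bracket c Y Z) \<in> bracket_space c UNIV (bracket_space c UNIV UNIV)"
        by (subst bracket_space_def, intro vec.span_base) blast
      then show "bracket c X (bracket c Y Z) = 0"
        using L by simp
    qed
  next
    assume R: ?R
    have "bracket c X W = 0" if "W \<in> bracket_space c UNIV UNIV" for X W
      using that unfolding bracket_space_def
      by (induction rule: vec.span_induct_alt)
        (auto simp: bracket_add_right bracket_scale_right R)
    then have "{bracket c X Y | X Y. X \<in> UNIV \<and> Y \<in> bracket_space c UNIV UNIV} \<subseteq> {0}"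
      by auto
    then have "bracket_space c UNIV (bracket_space c UNIV UNIV) \<subseteq> {0}"
      unfolding bracket_space_def[of c UNIV "bracket_space c UNIV UNIV"]
      by (rule vec.span_minimal) (simp add: vec.subspace_def)
    moreover have "0 \<in> bracket_space c UNIV (bracket_space c UNIV UNIV)"
      unfolding bracket_space_def[of c UNIV "bracket_space c UNIV UNIV"] by (rule vec.span_zero)
    ultimately show ?L
      by blast
  qed
  moreover have "\<forall>X Y Z. bracket c X (bracket c Y Z) + bracket c Y (bracket c Z X)
      + bracket c Z (bracket c X Y) = 0" if "\<forall>X Y Z. bracket c X (bracket c Y Z) = 0"
    using that by simp
  ultimately show ?thesis
    unfolding two_step_nilpotent_def lie_structures_def mem_Collect_eq by blast
qed

text \<open>By bilinearity both conditions need testing on basis vectors only, which turns them into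
  polynomial equations in the structure constants.\<close>

lemma two_step_nilpotent_iff:
  "c \<in> two_step_nilpotent \<longleftrightarrow>
     (\<forall>i j k. c $ i $ j $ k = - c $ j $ i $ k) \<and>
     (\<forall>i a b k. (\<Sum>l\<in>UNIV. c $ a $ b $ l * c $ i $ l $ k) = 0)" (is "_ \<longleftrightarrow> ?S \<and> ?T")
proof -
  have S: "(\<forall>X Y. bracket c X Y = - bracket c Y X) \<longleftrightarrow> ?S"
  proof
    assume *: "\<forall>X Y. bracket c X Y = - bracket c Y X"
    show ?S
    proof (intro allI)
      fix i j k
      have "bracket c (axis i 1) (axis j 1) = - bracket c (axis j 1) (axis i 1)"
        using * by blast
      then show "c $ i $ j $ k = - c $ j $ i $ k"
        unfolding bracket_axis by simp
    qed
  next
    assume *: ?S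
    show "\<forall>X Y. bracket c X Y = - bracket c Y X"
    proof (intro allI)
      fix X Y
      have "bracket c X Y $ k = - bracket c Y X $ k" for k
        unfolding bracket_nth
        by (subst sum.swap, subst *[rule_format]) (simp add: sum_negf mult_ac)
      then show "bracket c X Y = - bracket c Y X"
        by (simp add: vec_eq_iff)
    qed
  qed
  have e: "bracket c (axis i 1) Y $ k = (\<Sum>l\<in>UNIV. Y $ l * c $ i $ l $ k)" for i Y k
  proof -
    have "bracket c (axis i 1) Y = (\<Sum>l\<in>UNIV. Y $ l *s bracket c (axis i 1) (axis l 1))"
      by (subst (1) vec_eq_sum_axis)
        (simp only: vec.linear_sum[OF linear_bracket_right] bracket_scale_right)
    then show ?thesis
      by (simp add: bracket_axis)
  qed
  have T: "(\<forall>X Y Z. bracket c X (bracket c Y Z) = 0) \<longleftrightarrow> ?T"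
  proof
    assume *: "\<forall>X Y Z. bracket c X (bracket c Y Z) = 0"
    show ?T
    proof (intro allI)
      fix i a b k
      have "bracket c (axis i 1) (bracket c (axis a 1) (axis b 1)) $ k = 0"
        using * by simp
      then show "(\<Sum>l\<in>UNIV. c $ a $ b $ l * c $ i $ l $ k) = 0"
        by (simp add: bracket_axis e)
    qed
  next
    assume *: ?T
    have 1: "bracket c (axis i 1) (bracket c (axis a 1) (axis b 1)) = 0" for i a b
      by (simp add: vec_eq_iff bracket_axis e *)
    have 2: "bracket c (axis i 1) (bracket c Y Z) = 0" for i Y Z
      by (subst bilinear_expansion[where b = "\<lambda>Y Z. bracket c (axis i 1) (bracket c Y Z)"])
        (auto simp: 1 bracket_add_left bracket_add_right bracket_scale_left
          bracket_scale_right intro!: vec_linearI)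
    have "bracket c X (bracket c Y Z) = 0" for X Y Z
      by (subst vec_eq_sum_axis[of X])
        (simp only: vec.linear_sum[OF linear_bracket_left] bracket_scale_left 2, simp)
    then show "\<forall>X Y Z. bracket c X (bracket c Y Z) = 0"
      by blast
  qed
  show ?thesis
    unfolding two_step_nilpotent_iff_bracket S T ..
qed

lemma two_step_nilpotent_skew:
  "c \<in> two_step_nilpotent \<Longrightarrow> bracket c X Y = - bracket c Y X"
  unfolding two_step_nilpotent_iff_bracket by blast

lemma two_step_nilpotent_bracket_bracket:
  "c \<in> two_step_nilpotent \<Longrightarrow> bracket c X (bracket c Y Z) = 0"
  unfolding two_step_nilpotent_iff_bracket by blast

lemma change_basis_two_step_nilpotent:
  assumes "invertible g" "c \<in> two_step_nilpotent"
  shows "change_basis g c \<in> two_step_nilpotent"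
proof -
  have "bracket (change_basis g c) X Y = - bracket (change_basis g c) Y X" for X Y
    unfolding bracket_change_basis
    by (subst two_step_nilpotent_skew[OF assms(2)]) (simp add: vec.neg)
  moreover have "bracket (change_basis g c) X (bracket (change_basis g c) Y Z) = 0" for X Y Z
    by (simp add: bracket_change_basis assms two_step_nilpotent_bracket_bracket)
  ultimately show ?thesis
    unfolding two_step_nilpotent_iff_bracket by blast
qed

lemma orbit_subset_two_step_nilpotent:
  "c \<in> two_step_nilpotent \<Longrightarrow> orbit c \<subseteq> two_step_nilpotent"
  by (auto simp: orbit_def change_basis_two_step_nilpotent)

lemma polynomial_fun_sum:
  assumes "\<And>x. x \<in> A \<Longrightarrow> polynomial_fun (f x)"
  shows "polynomial_fun (\<lambda>c. \<Sum>x\<in>A. f x c)"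
  using assms by (induction A rule: infinite_finite_induct)
    (auto intro: polynomial_fun.const polynomial_fun.add)

text \<open>Because of this, orbit closures formed in the space of all structure constants stay
  inside the variety.\<close>

lemma algebraic_set_two_step_nilpotent: "algebraic_set two_step_nilpotent"
proof -
  let ?P = "range (\<lambda>(i, j, k) c. c $ i $ j $ k + c $ j $ i $ k) \<union>
    range (\<lambda>(i, a, b, k) c. \<Sum>l\<in>UNIV. c $ a $ b $ l * c $ i $ l $ k)"
  have "polynomial_fun p" if "p \<in> ?P" for p
    using that by (auto intro!: polynomial_fun.intros polynomial_fun_sum)
  moreover have "two_step_nilpotent = zero_locus ?P"
    unfolding zero_locus_def set_eq_iff two_step_nilpotent_iff
    by (simp add: ball_Un eq_neg_iff_add_eq_0)
  ultimately show ?thesis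
    unfolding algebraic_set_def by blast
qed

section \<open>Irreducibility\<close>

text \<open>A closed set that contains \<open>S\<close> also contains its closure, so a closed cover
  of the closure is decided on \<open>S\<close>.\<close>

lemma irreducible_in_closure_of:
  assumes "irreducible_in X S"
  shows "irreducible_in X (X closure_of S)"
proof -
  have S: "S \<subseteq> X closure_of S"
    using assms by (simp add: irreducible_in_def closure_of_subset)
  show ?thesis
    unfolding irreducible_in_def
  proof (intro conjI allI impI)
    show "X closure_of S \<subseteq> topspace X" "X closure_of S \<noteq> {}"
      using assms S by (auto simp: irreducible_in_def closure_of_subset_topspace)
    fix A B assume AB: "closedin X A" "closedin X B" "X closure_of S \<subseteq> A \<union> B"
    then have "S \<subseteq> A \<or> S \<subseteq> B"
      using assms S unfolding irreducible_in_def by (meson subset_trans)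
    then show "X closure_of S \<subseteq> A \<or> X closure_of S \<subseteq> B"
      using AB by (auto dest: closure_of_minimal)
  qed
qed

lemma irreducible_in_subtopology:
  assumes "irreducible_in X S" "S \<subseteq> N"
  shows "irreducible_in (subtopology X N) S"
  unfolding irreducible_in_def
proof (intro conjI allI impI)
  show "S \<subseteq> topspace (subtopology X N)" "S \<noteq> {}"
    using assms by (auto simp: irreducible_in_def)
  fix A B assume AB: "closedin (subtopology X N) A" "closedin (subtopology X N) B" "S \<subseteq> A \<union> B"
  then obtain A' B' where *: "closedin X A'" "closedin X B'" "A = A' \<inter> N" "B = B' \<inter> N"
    by (auto simp: closedin_subtopology)
  then have "S \<subseteq> A' \<or> S \<subseteq> B'"
    using assms(1) AB(3) unfolding irreducible_in_def by blast
  then show "S \<subseteq> A \<or> S \<subseteq> B"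
    using * assms(2) by blast
qed

lemma irreducible_in_subset_Union:
  assumes "finite \<C>" "irreducible_in X S" "\<And>C. C \<in> \<C> \<Longrightarrow> closedin X C" "S \<subseteq> \<Union>\<C>"
  shows "\<exists>C\<in>\<C>. S \<subseteq> C"
  using assms
proof (induction \<C> rule: finite_induct)
  case empty
  then show ?case
    by (simp add: irreducible_in_def)
next
  case (insert C \<C>)
  have "closedin X (\<Union>\<C>)"
    using insert by (intro closedin_Union) auto
  then have "S \<subseteq> C \<or> S \<subseteq> \<Union>\<C>"
    using insert.prems unfolding irreducible_in_def by (metis Union_insert insertI1)
  then show ?case
    using insert by auto
qed

text \<open>An irreducible set lies in one member of a finite closed cover. Hence a maximal one
  equals a member, and since no member contains another, every member is maximal.\<close>

lemma irreducible_components_eqI: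
  assumes "finite \<C>" "topspace X \<subseteq> \<Union>\<C>"
    and C: "\<And>C. C \<in> \<C> \<Longrightarrow> closedin X C" "\<And>C. C \<in> \<C> \<Longrightarrow> irreducible_in X C"
    and antichain: "\<And>C D. C \<in> \<C> \<Longrightarrow> D \<in> \<C> \<Longrightarrow> C \<subseteq> D \<Longrightarrow> C = D"
  shows "irreducible_components X = \<C>"
proof -
  have *: "\<exists>C\<in>\<C>. S \<subseteq> C" if "irreducible_in X S" for S
  proof (rule irreducible_in_subset_Union[OF assms(1) that])
    show "S \<subseteq> \<Union>\<C>"
      using that assms(2) unfolding irreducible_in_def by blast
  qed (rule C(1))
  show ?thesis
  proof (intro subset_antisym subsetI)
    fix S assume "S \<in> irreducible_components X"
    then have S: "irreducible_in X S" "\<And>T. irreducible_in X T \<Longrightarrow> S \<subseteq> T \<Longrightarrow> S = T"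
      by (auto simp: irreducible_components_def)
    show "S \<in> \<C>"
      using *[OF S(1)] S(2) C(2) by metis
  next
    fix C assume "C \<in> \<C>"
    then show "C \<in> irreducible_components X"
      unfolding irreducible_components_def mem_Collect_eq
      by (metis * C(2) antichain subset_antisym subset_trans)
  qed
qed

section \<open>Clearing the denominators of a change of basis\<close>

text \<open>Subrings of functions containing the constants. The instances are polynomial functions
  of one variable, polynomial functions of structure constants, and the localisations of such a ring
  at a determinant.\<close>

locale function_ring =
  fixes R :: "('x \<Rightarrow> complex) set"
  assumes const: "(\<lambda>x. a) \<in> R"
    and add: "f \<in> R \<Longrightarrow> h \<in> R \<Longrightarrow> (\<lambda>x. f x + h x) \<in> R"
    and mult: "f \<in> R \<Longrightarrow> h \<in> R \<Longrightarrow> (\<lambda>x. f x * h x) \<in> R"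
begin

lemma sum: "(\<And>i. i \<in> A \<Longrightarrow> f i \<in> R) \<Longrightarrow> (\<lambda>x. \<Sum>i\<in>A. f i x) \<in> R"
  by (induction A rule: infinite_finite_induct) (auto intro: const add)

lemma prod: "(\<And>i. i \<in> A \<Longrightarrow> f i \<in> R) \<Longrightarrow> (\<lambda>x. \<Prod>i\<in>A. f i x) \<in> R"
  by (induction A rule: infinite_finite_induct) (auto intro: const mult)

lemma power: "f \<in> R \<Longrightarrow> (\<lambda>x. f x ^ n) \<in> R"
  by (induction n) (auto intro: const mult)

lemma det:
  fixes g :: "'x \<Rightarrow> complex ^ 'n ^ 'n"
  assumes "\<And>i j. (\<lambda>x. g x $ i $ j) \<in> R"
  shows "(\<lambda>x. det (g x)) \<in> R"
  unfolding det_def by (intro sum mult const prod assms)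

lemma polynomial_fun_comp:
  assumes "polynomial_fun p" "\<And>i j k. (\<lambda>x. c x $ i $ j $ k) \<in> R"
  shows "(\<lambda>x. p (c x)) \<in> R"
  using assms by induction (auto intro: const add mult)

text \<open>The localisation of \<open>R\<close> at \<open>det (g x)\<close>: functions that become
  members of \<open>R\<close> after multiplication by a power of the determinant. Values at points
  with singular \<open>g x\<close> are left free.\<close>

definition cleared :: "('x \<Rightarrow> complex ^ 'n ^ 'n) \<Rightarrow> ('x \<Rightarrow> complex) set" where
  "cleared g = {f. \<exists>N. \<exists>q\<in>R. \<forall>x. det (g x) \<noteq> 0 \<longrightarrow> f x * det (g x) ^ N = q x}"

lemma clearedI:
  assumes "q \<in> R" "\<And>x. det (g x) \<noteq> 0 \<Longrightarrow> f x * det (g x) ^ N = q x"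
  shows "f \<in> cleared g"
  unfolding cleared_def mem_Collect_eq
  by (rule exI[of _ N], rule bexI[of _ q]) (simp_all add: assms)

lemma clearedE:
  assumes "f \<in> cleared g"
  obtains N q where "q \<in> R" "\<And>x. det (g x) \<noteq> 0 \<Longrightarrow> f x * det (g x) ^ N = q x"
  using assms unfolding cleared_def by auto

lemma subset_cleared: "f \<in> R \<Longrightarrow> f \<in> cleared g"
  by (rule clearedI[where N = 0]) simp_all

lemma function_ring_cleared:
  fixes g :: "'x \<Rightarrow> complex ^ 'n ^ 'n"
  assumes g: "\<And>i j. (\<lambda>x. g x $ i $ j) \<in> R"
  shows "function_ring (cleared g)"
proof
  fix f h assume fh: "f \<in> cleared g" "h \<in> cleared g"
  obtain M q where f: "q \<in> R" "\<And>x. det (g x) \<noteq> 0 \<Longrightarrow> f x * det (g x) ^ M = q x"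
    using fh(1) by (rule clearedE) blast
  obtain N r where h: "r \<in> R" "\<And>x. det (g x) \<noteq> 0 \<Longrightarrow> h x * det (g x) ^ N = r x"
    using fh(2) by (rule clearedE) blast
  have "(f x + h x) * det (g x) ^ (M + N) = q x * det (g x) ^ N + r x * det (g x) ^ M"
    if "det (g x) \<noteq> 0" for x
    unfolding f(2)[OF that, symmetric] h(2)[OF that, symmetric]
    by (simp add: power_add algebra_simps)
  moreover have "(\<lambda>x. q x * det (g x) ^ N + r x * det (g x) ^ M) \<in> R"
    by (intro add mult power det f h g)
  ultimately show "(\<lambda>x. f x + h x) \<in> cleared g"
    by (rule clearedI[rotated])
  have "(f x * h x) * det (g x) ^ (M + N) = q x * r x" if "det (g x) \<noteq> 0" for x
    unfolding f(2)[OF that, symmetric] h(2)[OF that, symmetric]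
    by (simp add: power_add algebra_simps)
  moreover have "(\<lambda>x. q x * r x) \<in> R"
    by (intro mult f h)
  ultimately show "(\<lambda>x. f x * h x) \<in> cleared g"
    by (rule clearedI[rotated])
qed (intro subset_cleared const)

text \<open>By Cramer's rule an entry of the inverse is a determinant with entries in
  \<open>R\<close> divided by \<open>det (g x)\<close>.\<close>

lemma matrix_inv_cleared:
  fixes g :: "'x \<Rightarrow> complex ^ 'n ^ 'n"
  assumes g: "\<And>i j. (\<lambda>x. g x $ i $ j) \<in> R"
  shows "(\<lambda>x. matrix_inv (g x) $ a $ i) \<in> cleared g"
proof -
  \<comment> \<open>The matrix \<open>g x\<close> with column \<open>a\<close> replaced by the basis
    vector with index \<open>i\<close>.\<close>
  let ?h = "\<lambda>x. \<chi> r s. if s = a then if r = i then 1 else 0 else g x $ r $ s"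
  have "matrix_inv (g x) $ a $ i * det (g x) ^ 1 = det (?h x)" if "det (g x) \<noteq> 0" for x
  proof -
    have "g x *v (matrix_inv (g x) *v axis i 1) = axis i 1"
      using that by (simp add: invertible_det_nz)
    then have "(matrix_inv (g x) *v axis i 1) $ a * det (g x) =
        det (\<chi> r s. if s = a then axis i 1 $ r else g x $ r $ s)"
      using that by (subst (asm) cramer) simp_all
    then show ?thesis
      by (simp only: matrix_vector_mult_axis) (simp add: axis_def cong: if_cong)
  qed
  moreover have "(\<lambda>x. det (?h x)) \<in> R"
  proof (rule det)
    show "(\<lambda>x. ?h x $ r $ s) \<in> R" for r s
      by (cases "s = a"; cases "r = i") (simp_all add: g const)
  qed
  ultimately show ?thesis
    by (rule clearedI[rotated])
qed

lemma change_basis_cleared: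
  fixes g :: "'x \<Rightarrow> complex ^ 'n ^ 'n"
  assumes g: "\<And>i j. (\<lambda>x. g x $ i $ j) \<in> R" and c: "\<And>i j k. (\<lambda>x. c x $ i $ j $ k) \<in> R"
    and p: "polynomial_fun p"
  shows "\<exists>N. \<exists>q\<in>R. \<forall>x. det (g x) \<noteq> 0 \<longrightarrow> p (change_basis (g x) (c x)) * det (g x) ^ N = q x"
    and "\<exists>N. \<exists>q\<in>R. \<forall>x. det (g x) \<noteq> 0 \<longrightarrow>
           p (change_basis (matrix_inv (g x)) (c x)) * det (g x) ^ N = q x"
proof -
  interpret cl: function_ring "cleared g"
    by (rule function_ring_cleared) (rule g)
  have g': "(\<lambda>x. g x $ i $ j) \<in> cleared g" for i j
    by (intro subset_cleared g)
  have c': "(\<lambda>x. c x $ i $ j $ k) \<in> cleared g" for i j k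
    by (intro subset_cleared c)
  have "(\<lambda>x. p (change_basis (g x) (c x))) \<in> cleared g"
    by (rule cl.polynomial_fun_comp[OF p], unfold change_basis_nth)
      (intro cl.sum cl.mult g' c' matrix_inv_cleared g)
  then show "\<exists>N. \<exists>q\<in>R. \<forall>x. det (g x) \<noteq> 0 \<longrightarrow>
      p (change_basis (g x) (c x)) * det (g x) ^ N = q x"
    by (simp add: cleared_def)
  \<comment> \<open>In place of the inverse of an inverse, \<open>g x\<close> itself is used; the
    two agree wherever the determinant does not vanish, and only one inverse is left to
    clear.\<close>
  have "(\<lambda>x. p (constants_of (\<lambda>X Y. matrix_inv (g x) *v bracket (c x) (g x *v X) (g x *v Y))))
      \<in> cleared g"
  proof (rule cl.polynomial_fun_comp[OF p])
    fix i j k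
    have "(\<lambda>x. constants_of (\<lambda>X Y. matrix_inv (g x) *v bracket (c x) (g x *v X) (g x *v Y))
          $ i $ j $ k) =
        (\<lambda>x. \<Sum>l\<in>UNIV. matrix_inv (g x) $ k $ l *
          (\<Sum>a\<in>UNIV. \<Sum>b\<in>UNIV. g x $ a $ i * g x $ b $ j * c x $ a $ b $ l))"
      by (simp add: constants_of_def matrix_vector_mult_def[of "matrix_inv _"] bracket_nth
          matrix_vector_mult_axis)
    moreover have "\<dots> \<in> cleared g"
      by (intro cl.sum cl.mult g' c' matrix_inv_cleared g)
    ultimately show "(\<lambda>x. constants_of (\<lambda>X Y. matrix_inv (g x) *v bracket (c x) (g x *v X)
        (g x *v Y)) $ i $ j $ k) \<in> cleared g"
      by simp
  qed
  moreover have "change_basis (matrix_inv (g x)) (c x) =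
      constants_of (\<lambda>X Y. matrix_inv (g x) *v bracket (c x) (g x *v X) (g x *v Y))"
    if "det (g x) \<noteq> 0" for x
    using that by (simp add: change_basis_def matrix_inv_matrix_inv invertible_det_nz)
  ultimately show "\<exists>N. \<exists>q\<in>R. \<forall>x. det (g x) \<noteq> 0 \<longrightarrow>
      p (change_basis (matrix_inv (g x)) (c x)) * det (g x) ^ N = q x"
    by (simp add: cleared_def)
qed

end

section \<open>Restriction to lines and irreducibility of orbits\<close>

interpretation poly: function_ring "range poly"
proof
  show "(\<lambda>x. a) \<in> range poly" for a :: complex
    by (rule range_eqI[of _ _ "[:a:]"]) auto
  fix f h :: "complex \<Rightarrow> complex" assume "f \<in> range poly" "h \<in> range poly"
  then obtain p q where "f = poly p" "h = poly q"
    by blast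
  then have "(\<lambda>x. f x + h x) = poly (p + q)" "(\<lambda>x. f x * h x) = poly (p * q)"
    by (simp_all add: fun_eq_iff)
  then show "(\<lambda>x. f x + h x) \<in> range poly" "(\<lambda>x. f x * h x) \<in> range poly"
    by blast+
qed

interpretation polynomial_fun: function_ring "Collect polynomial_fun"
  by standard (auto intro: polynomial_fun.intros)

lemma line_in_range_poly: "(\<lambda>t. a + t * b) \<in> range (poly :: complex poly \<Rightarrow> _)"
  by (rule range_eqI[of _ _ "[:a, b:]"]) auto

text \<open>Two points of an orbit are joined by the image of a line of matrices, on which a polynomial
  function becomes a polynomial in one variable after clearing denominators.\<close>

lemma irreducible_in_orbit: "irreducible_in zariski (orbit c)"
  unfolding irreducible_in_def
proof (intro conjI allI impI)
  fix A B
  assume A: "closedin zariski A" and B: "closedin zariski B" and AB: "orbit c \<subseteq> A \<union> B"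
  obtain P where P: "\<And>p. p \<in> P \<Longrightarrow> polynomial_fun p" "A = zero_locus P"
    using A unfolding closedin_zariski algebraic_set_def by blast
  obtain Q where Q: "\<And>q. q \<in> Q \<Longrightarrow> polynomial_fun q" "B = zero_locus Q"
    using B unfolding closedin_zariski algebraic_set_def by blast
  show "orbit c \<subseteq> A \<or> orbit c \<subseteq> B"
  proof (rule ccontr)
    assume "\<not> (orbit c \<subseteq> A \<or> orbit c \<subseteq> B)"
    then obtain x y where xy: "x \<in> orbit c" "x \<notin> A" "y \<in> orbit c" "y \<notin> B"
      by blast
    then obtain g h where g: "invertible g" "x = change_basis g c"
      and h: "invertible h" "y = change_basis h c"
      unfolding orbit_def by blast
    obtain p q where p: "p \<in> P" "p x \<noteq> 0" and q: "q \<in> Q" "q y \<noteq> 0"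
      using xy P(2) Q(2) unfolding zero_locus_def by blast
    define \<gamma> where "\<gamma> t = (\<chi> i j. g $ i $ j + t * (h $ i $ j - g $ i $ j))" for t
    have \<gamma>: "(\<lambda>t. \<gamma> t $ i $ j) \<in> range poly" for i j
      by (simp add: \<gamma>_def line_in_range_poly)
    have \<gamma>01: "\<gamma> 0 = g" "\<gamma> 1 = h"
      by (simp_all add: \<gamma>_def vec_eq_iff)
    obtain d where d: "\<And>t. det (\<gamma> t) = poly d t"
      using poly.det[OF \<gamma>] by (metis imageE)
    obtain M p' where p': "\<And>t. poly d t \<noteq> 0 \<Longrightarrow>
        p (change_basis (\<gamma> t) c) * poly d t ^ M = poly p' t"
      using poly.change_basis_cleared(1)[OF \<gamma> poly.const P(1)[OF p(1)]] unfolding d by blast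
    obtain N q' where q': "\<And>t. poly d t \<noteq> 0 \<Longrightarrow>
        q (change_basis (\<gamma> t) c) * poly d t ^ N = poly q' t"
      using poly.change_basis_cleared(1)[OF \<gamma> poly.const Q(1)[OF q(1)]] unfolding d by blast
    have d01: "poly d 0 \<noteq> 0" "poly d 1 \<noteq> 0"
      using g(1) h(1) by (simp_all add: invertible_det_nz \<gamma>01 flip: d)
    \<comment> \<open>The factor \<open>d\<close> takes care of the parameters at which
      \<open>\<gamma> t\<close> is singular and gives no point of the orbit.\<close>
    have "poly (p' * q' * d) t = 0" for t
    proof (cases "poly d t = 0")
      case False
      then have "change_basis (\<gamma> t) c \<in> orbit c"
        by (intro change_basis_in_orbit) (simp add: d invertible_det_nz)
      then have "change_basis (\<gamma> t) c \<in> A \<union> B"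
        using AB by blast
      then have "p (change_basis (\<gamma> t) c) = 0 \<or> q (change_basis (\<gamma> t) c) = 0"
        using p(1) q(1) P(2) Q(2) by (auto simp: zero_locus_def)
      then show ?thesis
        using p'[OF False] q'[OF False] by auto
    qed simp
    then have "p' * q' * d = 0"
      using poly_all_0_iff_0 by blast
    \<comment> \<open>The endpoints are \<open>x\<close> and \<open>y\<close>, where
      \<open>p\<close> and \<open>q\<close> respectively do not vanish. So none of the three factors
      is the zero polynomial.\<close>
    moreover have "poly p' 0 \<noteq> 0" "poly q' 1 \<noteq> 0"
      using p'[OF d01(1)] q'[OF d01(2)] p(2) q(2) d01 by (auto simp: \<gamma>01 g(2) h(2))
    ultimately show False
      using d01 by auto
  qed
next
  show "orbit c \<subseteq> topspace zariski"
    by simp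
  show "orbit c \<noteq> {}"
    using orbit_refl by blast
qed

section \<open>Zariski continuity of the action\<close>

lemma closedin_zariski_change_basis:
  assumes g: "invertible g" and A: "closedin zariski A"
  shows "closedin zariski {c. change_basis g c \<in> A}"
proof -
  obtain P where P: "\<And>p. p \<in> P \<Longrightarrow> polynomial_fun p" "A = zero_locus P"
    using A unfolding closedin_zariski algebraic_set_def by blast
  have "polynomial_fun (\<lambda>c. change_basis g c $ i $ j $ k)" for i j k
    unfolding change_basis_nth by (intro polynomial_fun_sum polynomial_fun.intros)
  then have "polynomial_fun (\<lambda>c. p (change_basis g c))" if "polynomial_fun p" for p
    using polynomial_fun.polynomial_fun_comp[OF that, of "change_basis g"] by simp
  then have "\<forall>p\<in>(\<lambda>p c. p (change_basis g c)) ` P. polynomial_fun p"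
    using P(1) by blast
  moreover have "{c. change_basis g c \<in> A} = zero_locus ((\<lambda>p c. p (change_basis g c)) ` P)"
    by (auto simp: P(2) zero_locus_def)
  ultimately show ?thesis
    unfolding closedin_zariski algebraic_set_def by blast
qed

lemma openin_zariski_change_basis:
  assumes "invertible g" "openin zariski U"
  shows "openin zariski {c. change_basis g c \<in> U}"
proof -
  have "{c. change_basis g c \<in> - U} = - {c. change_basis g c \<in> U}"
    by auto
  then show ?thesis
    using closedin_zariski_change_basis[OF assms(1), of "- U"] assms(2)
    by (simp add: closedin_zariski openin_zariski)
qed

lemma openin_zariski_nonzero: "polynomial_fun p \<Longrightarrow> openin zariski {c. p c \<noteq> 0}"
  unfolding openin_zariski algebraic_set_def zero_locus_def
  by (intro exI[of _ "{p}"]) auto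

text \<open>The preimage of the closure under \<open>g\<close> is closed and contains the orbit,
  hence contains the closure.\<close>

lemma closure_of_orbit_invariant:
  assumes g: "invertible g" and x: "x \<in> zariski closure_of (orbit c)"
  shows "change_basis g x \<in> zariski closure_of (orbit c)"
proof -
  let ?A = "{x. change_basis g x \<in> zariski closure_of (orbit c)}"
  have "orbit c \<subseteq> ?A"
  proof
    fix y assume "y \<in> orbit c"
    then have "change_basis g y \<in> orbit c"
      using g change_basis_in_orbit orbit_trans by blast
    then show "y \<in> ?A"
      using closure_of_subset[of "orbit c" zariski] by auto
  qed
  then have "zariski closure_of (orbit c) \<subseteq> ?A"
    by (intro closure_of_minimal closedin_zariski_change_basis g closedin_closure_of)
  then show ?thesis
    using x by blast
qed

text \<open>The translates of one open neighbourhood of \<open>c\<close> cover the orbit, so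
  openness has to be checked near a single point only.\<close>

lemma openin_orbitI:
  assumes N: "orbit c \<subseteq> N" "\<And>g x. invertible g \<Longrightarrow> x \<in> N \<Longrightarrow> change_basis g x \<in> N"
    and U: "openin zariski U" "c \<in> U" "U \<inter> N \<subseteq> orbit c"
  shows "openin (subtopology zariski N) (orbit c)"
proof -
  let ?V = "\<Union>g\<in>Collect invertible. {x. change_basis g x \<in> U}"
  have "openin zariski ?V"
    by (intro openin_Union) (auto intro: openin_zariski_change_basis U(1))
  moreover have "orbit c = ?V \<inter> N"
  proof (intro subset_antisym subsetI)
    fix x assume x: "x \<in> orbit c"
    then obtain g where "invertible g" "c = change_basis g x"
      using orbit_sym unfolding orbit_def by blast
    then show "x \<in> ?V \<inter> N"
      using N(1) U(2) x by auto
  next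
    fix x assume "x \<in> ?V \<inter> N"
    then obtain g where g: "invertible g" "change_basis g x \<in> U" "x \<in> N"
      by auto
    then have "change_basis g x \<in> orbit c"
      using N(2) U(3) by blast
    moreover have "x \<in> orbit (change_basis g x)"
      by (rule orbit_sym[OF change_basis_in_orbit[OF g(1)]])
    ultimately show "x \<in> orbit c"
      by (rule orbit_trans[rotated])
  qed
  ultimately show ?thesis
    by (auto simp: openin_subtopology)
qed

section \<open>Structures with a prescribed central subspace\<close>

text \<open>The structures for which the span of the basis vectors indexed by \<open>J\<close> is central and
  contains the derived algebra, which is a linear space.\<close>

definition block_space :: "'n set \<Rightarrow> 'n::finite structure_constants set" where
  "block_space J = {c. (\<forall>i j k. c $ i $ j $ k = - c $ j $ i $ k) \<and>
     (\<forall>i j k. i \<in> J \<or> j \<in> J \<or> k \<notin> J \<longrightarrow> c $ i $ j $ k = 0)}"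

text \<open>A linear projection of all structure constants onto \<open>block_space J\<close>. It
  supplies a complement, so that maps into the block space can be extended to maps onto the full
  space.\<close>

definition block_proj :: "'n set \<Rightarrow> 'n::finite structure_constants \<Rightarrow> 'n structure_constants" where
  "block_proj J v = (\<chi> i j k. if i \<in> J \<or> j \<in> J \<or> k \<notin> J then 0
     else (v $ i $ j $ k - v $ j $ i $ k) / 2)"

text \<open>The diagonal blocks of \<open>M\<close> act on the values and, from the right, on the arguments
  of the bracket.\<close>

definition block_act :: "'n set \<Rightarrow> 'n::finite structure_constants \<Rightarrow> complex ^ 'n ^ 'n
    \<Rightarrow> 'n structure_constants" where
  "block_act J c M = (\<chi> i j k. if i \<in> J \<or> j \<in> J \<or> k \<notin> J then 0
     else (\<Sum>p\<in>UNIV. M $ k $ p * (\<Sum>a\<in>UNIV. M $ a $ i * (\<Sum>b\<in>UNIV. M $ b $ j * c $ a $ b $ p))))"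

text \<open>The differential of \<open>block_act J c\<close> at the identity matrix, that is, the
  infinitesimal action.\<close>

definition block_tangent :: "'n set \<Rightarrow> 'n::finite structure_constants \<Rightarrow> complex ^ 'n ^ 'n
    \<Rightarrow> 'n structure_constants" where
  "block_tangent J c A = (\<chi> i j k. if i \<in> J \<or> j \<in> J \<or> k \<notin> J then 0
     else (\<Sum>p\<in>UNIV. A $ k $ p * c $ i $ j $ p) + (\<Sum>a\<in>UNIV. A $ a $ i * c $ a $ j $ k)
       + (\<Sum>b\<in>UNIV. A $ b $ j * c $ i $ b $ k))"

lemma block_space_skew: "c \<in> block_space J \<Longrightarrow> c $ i $ j $ k = - c $ j $ i $ k"
  unfolding block_space_def by blast

lemma block_space_zero:
  "c \<in> block_space J \<Longrightarrow> i \<in> J \<or> j \<in> J \<or> k \<notin> J \<Longrightarrow> c $ i $ j $ k = 0"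
  unfolding block_space_def by blast

lemma block_space_subset: "block_space J \<subseteq> two_step_nilpotent"
proof
  fix c assume c: "c \<in> block_space J"
  have "c $ a $ b $ l * c $ i $ l $ k = 0" for a b i k l
    by (cases "l \<in> J") (simp_all add: block_space_zero[OF c])
  then show "c \<in> two_step_nilpotent"
    unfolding two_step_nilpotent_iff
    by (intro conjI allI block_space_skew[OF c] sum.neutral ballI)
qed

lemma block_proj_in: "block_proj J v \<in> block_space J"
  by (simp add: block_space_def block_proj_def minus_divide_left)

lemma block_proj_id:
  assumes "v \<in> block_space J"
  shows "block_proj J v = v"
proof -
  have "(v $ i $ j $ k - v $ j $ i $ k) / 2 = v $ i $ j $ k" for i j k
    by (subst block_space_skew[OF assms, of j i]) simp
  then show ?thesis
    by (simp add: vec_eq_iff block_proj_def block_space_zero[OF assms])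
qed

lemma block_proj_add: "block_proj J (v + w) = block_proj J v + block_proj J w"
  by (simp add: vec_eq_iff block_proj_def add_divide_distrib diff_divide_distrib)

lemma block_proj_diff: "block_proj J (v - w) = block_proj J v - block_proj J w"
  by (simp add: vec_eq_iff block_proj_def add_divide_distrib diff_divide_distrib)

lemma block_proj_scaleR: "block_proj J (r *\<^sub>R v) = r *\<^sub>R block_proj J v"
proof -
  have "(r *\<^sub>R x - r *\<^sub>R y) / 2 = r *\<^sub>R ((x - y) / 2)" for x y :: complex
    by (simp add: scaleR_conv_of_real right_diff_distrib diff_divide_distrib)
  then show ?thesis
    by (simp only: vec_eq_iff block_proj_def vector_scaleR_component vec_lambda_beta) simp
qed

lemma block_act_skew:
  assumes "c \<in> block_space J"
  shows "block_act J c M \<in> block_space J"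
proof -
  have *: "(\<Sum>a\<in>UNIV. M $ a $ i * (\<Sum>b\<in>UNIV. M $ b $ j * c $ a $ b $ p)) =
      - (\<Sum>a\<in>UNIV. M $ a $ j * (\<Sum>b\<in>UNIV. M $ b $ i * c $ a $ b $ p))" for i j p
    unfolding sum_distrib_left
    by (subst sum.swap, subst block_space_skew[OF assms]) (simp add: sum_negf mult_ac)
  have "block_act J c M $ i $ j $ k = - block_act J c M $ j $ i $ k" for i j k
    unfolding block_act_def vec_lambda_beta by (subst *) (simp add: sum_negf)
  moreover have "block_act J c M $ i $ j $ k = 0" if "i \<in> J \<or> j \<in> J \<or> k \<notin> J" for i j k
    using that by (simp add: block_act_def)
  ultimately show ?thesis
    unfolding block_space_def by blast
qed

text \<open>The coordinates indexed by \<open>J\<close> belong to central directions and do not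
  influence brackets.\<close>

lemma bracket_block_cong:
  assumes c: "c \<in> block_space J" and "\<And>i. i \<notin> J \<Longrightarrow> X $ i = X' $ i" "\<And>i. i \<notin> J \<Longrightarrow> Y $ i = Y' $ i"
  shows "bracket c X Y = bracket c X' Y'"
proof -
  have "X $ i * Y $ j * c $ i $ j $ k = X' $ i * Y' $ j * c $ i $ j $ k" for i j k
    by (cases "i \<in> J \<or> j \<in> J") (auto simp: assms block_space_zero[OF c])
  then show ?thesis
    unfolding vec_eq_iff bracket_nth by (intro allI sum.cong refl)
qed

lemma sum_mat_1_left: "(\<Sum>p\<in>UNIV. mat 1 $ k $ p * f p) = (f k :: complex)"
  by (simp add: mat_def if_distrib[of "\<lambda>x. x * _"] cong: if_cong)

lemma sum_mat_1_right: "(\<Sum>a\<in>UNIV. mat 1 $ a $ i * f a) = (f i :: complex)"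
  by (simp add: mat_def if_distrib[of "\<lambda>x. x * _"] cong: if_cong)

lemma block_act_mat_1:
  assumes "c \<in> block_space J"
  shows "block_act J c (mat 1) = c"
  by (simp add: vec_eq_iff block_act_def sum_mat_1_left sum_mat_1_right block_space_zero[OF assms])

text \<open>The block is completed by the identity to a matrix of full size, so that it can act by
  change of basis.\<close>

definition diagonal_block :: "'n set \<Rightarrow> complex ^ 'n ^ 'n \<Rightarrow> complex ^ 'n ^ 'n" where
  "diagonal_block J M = (\<chi> i j. if i \<in> J \<and> j \<in> J then M $ i $ j else mat 1 $ i $ j)"

lemma diagonal_block_mat_1: "diagonal_block J (mat 1) = mat 1"
  by (simp add: vec_eq_iff diagonal_block_def)

lemma diagonal_block_mult_notin:
  assumes "i \<notin> J"
  shows "(diagonal_block J M *v X) $ i = X $ i"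
  using assms by (simp add: diagonal_block_def matrix_vector_mult_def sum_mat_1_left)

text \<open>The block on \<open>J\<close> moves only values and the block on the complement only
  arguments, so each can be treated as a separate change of basis. Letting the second act
  contravariantly is what keeps \<open>block_act\<close> polynomial in \<open>M\<close>.\<close>

lemma block_act_in_orbit:
  assumes c: "c \<in> block_space J"
    and inv: "invertible (diagonal_block J M)" "invertible (diagonal_block (- J) M)"
  shows "block_act J c M \<in> orbit c"
proof -
  let ?G = "diagonal_block J M" and ?H = "diagonal_block (- J) M"
  \<comment> \<open>The structure in which the two changes of basis meet: \<open>?G\<close> carries
    \<open>c\<close> to it, and \<open>?H\<close> carries \<open>block_act J c M\<close> to
    it.\<close>
  define c1 where "c1 = constants_of (\<lambda>X Y. ?G *v bracket c X Y)"
  have c1: "bracket c1 X Y = ?G *v bracket c X Y" for X Y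
    unfolding c1_def
    by (rule bracket_constants_of; rule vec_linearI)
      (simp_all add: matrix_vector_right_distrib bracket_add_left bracket_add_right
        vector_scalar_commute bracket_scale_left bracket_scale_right)
  have "change_basis ?G c = c1"
  proof (rule change_basis_eqI[OF inv(1)])
    show "bracket c1 (?G *v X) (?G *v Y) = ?G *v bracket c X Y" for X Y
      unfolding c1
      by (subst bracket_block_cong[OF c]) (auto simp: diagonal_block_mult_notin)
  qed
  moreover have "change_basis ?H (block_act J c M) = c1"
  proof (rule change_basis_eqI[OF inv(2)])
    have "block_act J c M = constants_of (\<lambda>X Y. ?G *v bracket c (?H *v X) (?H *v Y))"
    proof -
      have H: "(?H *v axis i 1) $ a = (if a \<notin> J \<and> i \<notin> J then M $ a $ i else mat 1 $ a $ i)" for a i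
        by (simp add: matrix_vector_mult_axis diagonal_block_def)
      have "block_act J c M $ i $ j $ k =
          (?G *v bracket c (?H *v axis i 1) (?H *v axis j 1)) $ k" for i j k
      proof (cases "i \<in> J \<or> j \<in> J \<or> k \<notin> J")
        case True
        have "(?H *v axis i 1) $ a * (?H *v axis j 1) $ b * c $ a $ b $ p = 0"
          if "i \<in> J \<or> j \<in> J" for a b p
          using that unfolding H
          by (cases "a \<in> J \<or> b \<in> J") (auto simp: mat_def block_space_zero[OF c])
        moreover have "?G $ k $ p *
            ((?H *v axis i 1) $ a * (?H *v axis j 1) $ b * c $ a $ b $ p) = 0"
          if "k \<notin> J" for a b p
          using that
          by (cases "p \<in> J") (auto simp: diagonal_block_def mat_def block_space_zero[OF c])
        ultimately have "?G $ k $ p *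
            ((?H *v axis i 1) $ a * (?H *v axis j 1) $ b * c $ a $ b $ p) = 0"
          for a b p
          using True by fastforce
        then have "(?G *v bracket c (?H *v axis i 1) (?H *v axis j 1)) $ k = 0"
          unfolding matrix_vector_mult_def[of ?G] vec_lambda_beta bracket_nth sum_distrib_left
          by (intro sum.neutral ballI)
        with True show ?thesis
          by (simp add: block_act_def)
      next
        case False
        then have *: "?G $ k $ p * ((?H *v axis i 1) $ a * (?H *v axis j 1) $ b * c $ a $ b $ p) =
            M $ k $ p * (M $ a $ i * (M $ b $ j * c $ a $ b $ p))" for a b p
          unfolding H
          by (cases "a \<in> J \<or> b \<in> J \<or> p \<notin> J") (auto simp: diagonal_block_def block_space_zero[OF c])
        have "(?G *v bracket c (?H *v axis i 1) (?H *v axis j 1)) $ k =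
            (\<Sum>p\<in>UNIV. \<Sum>a\<in>UNIV. \<Sum>b\<in>UNIV. M $ k $ p * (M $ a $ i * (M $ b $ j * c $ a $ b $ p)))"
          unfolding matrix_vector_mult_def[of ?G] vec_lambda_beta bracket_nth sum_distrib_left
          by (intro sum.cong refl *)
        with False show ?thesis
          by (simp add: sum_distrib_left block_act_def)
      qed
      then show ?thesis
        by (simp add: vec_eq_iff constants_of_def)
    qed
    then have act: "bracket (block_act J c M) X Y = ?G *v bracket c (?H *v X) (?H *v Y)" for X Y
      by (simp only:) (rule bracket_constants_of; rule vec_linearI;
        simp add: matrix_vector_right_distrib bracket_add_left bracket_add_right
          vector_scalar_commute bracket_scale_left bracket_scale_right)
    show "bracket c1 (?H *v X) (?H *v Y) = ?H *v bracket (block_act J c M) X Y" for X Y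
    proof -
      have "bracket (block_act J c M) X Y $ k = 0" if "k \<notin> J" for k
        using that by (simp add: bracket_nth block_space_zero[OF block_act_skew[OF c]])
      \<comment> \<open>Values have coordinates only in \<open>J\<close>, where the columns of
        \<open>?H\<close> are those of the identity; so \<open>?H\<close> fixes them.\<close>
      then have "?H $ i $ k * bracket (block_act J c M) X Y $ k =
          mat 1 $ i $ k * bracket (block_act J c M) X Y $ k"
        for i k
        by (cases "k \<in> J") (simp_all add: diagonal_block_def)
      then have "?H *v bracket (block_act J c M) X Y = bracket (block_act J c M) X Y"
        by (simp only: vec_eq_iff matrix_vector_mult_def vec_lambda_beta sum_mat_1_left) simp
      then show ?thesis
        by (simp add: c1 act)
    qed
  qed
  ultimately show ?thesis
    by (metis change_basis_in_orbit inv orbit_sym orbit_trans)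
qed

section \<open>The derivative of the block action at the identity\<close>

lemma has_derivative_vec:
  fixes f :: "'a::real_normed_vector \<Rightarrow> ('b::real_normed_vector) ^ 'n"
  assumes "\<And>i. ((\<lambda>x. f x $ i) has_derivative (\<lambda>h. f' h $ i)) (at a)"
  shows "(f has_derivative f') (at a)"
proof -
  have lin: "bounded_linear (\<lambda>h. f' h $ i)" for i
    using assms by (rule has_derivative_bounded_linear)
  have "linear f'"
    by (rule linearI)
      (simp_all add: vec_eq_iff linear_simps[OF lin])
  moreover have "\<exists>K. \<forall>h. norm (f' h) \<le> norm h * K"
  proof -
    \<comment> \<open>The coordinatewise bounds are added to obtain one bound for the whole
      vector.\<close>
    obtain K where K: "\<And>i h. norm (f' h $ i) \<le> norm h * K i"
      using bounded_linear.bounded[OF lin] by metis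
    have "norm (f' h) \<le> norm h * (\<Sum>i\<in>UNIV. K i)" for h
    proof -
      have "norm (f' h) \<le> (\<Sum>i\<in>UNIV. norm (f' h $ i))"
        by (simp add: norm_vec_def L2_set_le_sum)
      also have "\<dots> \<le> (\<Sum>i\<in>UNIV. norm h * K i)"
        by (intro sum_mono K)
      finally show ?thesis
        by (simp add: sum_distrib_left)
    qed
    then show ?thesis
      by blast
  qed
  ultimately have "bounded_linear f'"
    by (simp add: bounded_linear_def bounded_linear_axioms_def)
  moreover have "((\<lambda>y. (f y - f a - f' (y - a)) /\<^sub>R norm (y - a)) \<longlongrightarrow> 0) (at a)"
    using assms unfolding has_derivative_at_within by (intro vec_tendstoI) simp
  ultimately show ?thesis
    by (simp add: has_derivative_at_within)
qed

lemma has_derivative_block_act: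
  "(block_act J c has_derivative block_tangent J c) (at (mat 1))"
proof (intro has_derivative_vec)
  fix i j k
  have *: "((\<lambda>M :: complex ^ 'n ^ 'n. M $ a $ b) has_derivative (\<lambda>A. A $ a $ b)) F" for a b F
    by (intro bounded_linear_imp_has_derivative bounded_linear_compose[OF bounded_linear_vec_nth]
        bounded_linear_vec_nth)
  show "((\<lambda>M. block_act J c M $ i $ j $ k) has_derivative (\<lambda>A. block_tangent J c A $ i $ j $ k))
      (at (mat 1))"
  proof (cases "i \<in> J \<or> j \<in> J \<or> k \<notin> J")
    case True
    then show ?thesis
      by (auto simp: block_act_def block_tangent_def)
  next
    case False
    have "((\<lambda>M. \<Sum>p\<in>UNIV. M $ k $ p * (\<Sum>a\<in>UNIV. M $ a $ i * (\<Sum>b\<in>UNIV. M $ b $ j * c $ a $ b $ p)))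
        has_derivative (\<lambda>A. (\<Sum>p\<in>UNIV. A $ k $ p * c $ i $ j $ p)
          + (\<Sum>a\<in>UNIV. A $ a $ i * c $ a $ j $ k) + (\<Sum>b\<in>UNIV. A $ b $ j * c $ i $ b $ k)))
        (at (mat 1))"
      by (rule derivative_eq_intros * refl)+
        (simp add: sum_mat_1_left sum_mat_1_right sum.distrib fun_eq_iff algebra_simps)
    with False show ?thesis
      by (simp add: block_act_def block_tangent_def)
  qed
qed

section \<open>The generic orbit in a space of block structures\<close>

text \<open>Complex linearity in coordinates, used to superpose solutions of the tangent equation
  for the individual basis tensors.\<close>

lemma block_tangent_sum:
  "block_tangent J c (\<chi> a b. \<Sum>y\<in>Y. u y * A y $ a $ b) $ i $ j $ k =
     (\<Sum>y\<in>Y. u y * block_tangent J c (A y) $ i $ j $ k)"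
proof -
  have "(\<Sum>p\<in>UNIV. (\<Sum>y\<in>Y. u y * A y $ f p $ g p) * h p) =
      (\<Sum>y\<in>Y. u y * (\<Sum>p\<in>UNIV. A y $ f p $ g p * h p))" for f g h :: "'a \<Rightarrow> _"
    by (simp add: sum_distrib_left sum_distrib_right mult_ac) (rule sum.swap)
  then show ?thesis
    by (simp add: block_tangent_def sum.distrib distrib_left)
qed

lemma block_proj_sum:
  "block_proj J (\<chi> a b d. \<Sum>y\<in>Y. u y * E y $ a $ b $ d) $ i $ j $ k =
     (\<Sum>y\<in>Y. u y * block_proj J (E y) $ i $ j $ k)"
  by (simp add: block_proj_def sum_subtractf right_diff_distrib sum_divide_distrib
      diff_divide_distrib)

text \<open>Where the infinitesimal action is onto, the open mapping theorem shows that the orbit is a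
  neighbourhood in the block space. That it is onto is the non-vanishing of a determinant.\<close>

lemma open_orbit_in_block_space:
  fixes c\<^sub>0 :: "'n::finite structure_constants"
  assumes onto: "\<And>w. w \<in> block_space J \<Longrightarrow> \<exists>A. block_tangent J c\<^sub>0 A = w"
  obtains D where "polynomial_fun D" "D c\<^sub>0 \<noteq> 0"
    "\<And>c. c \<in> block_space J \<Longrightarrow> D c \<noteq> 0 \<Longrightarrow> \<exists>e>0. \<forall>w\<in>block_space J. dist c w < e \<longrightarrow> w \<in> orbit c"
proof -
  define E :: "'n \<times> 'n \<times> 'n \<Rightarrow> 'n structure_constants"
    where "E = (\<lambda>y. \<chi> i j k. if (i, j, k) = y then 1 else 0)"
  have "\<forall>y. \<exists>A. block_tangent J c\<^sub>0 A = block_proj J (E y)"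
    using onto block_proj_in by blast
  then have "\<exists>A. \<forall>y. block_tangent J c\<^sub>0 (A y) = block_proj J (E y)"
    by (rule choice)
  then obtain A where A: "\<And>y. block_tangent J c\<^sub>0 (A y) = block_proj J (E y)"
    by blast
  \<comment> \<open>Column \<open>y\<close> is the image of the pair \<open>(A y, E y)\<close> under
    the infinitesimal action extended by the complement of the block space. The choice of
    \<open>A\<close> makes this matrix the identity at \<open>c\<^sub>0\<close>, and its entries are
    polynomial in \<open>c\<close>.\<close>
  define m :: "'n structure_constants \<Rightarrow> complex ^ ('n \<times> 'n \<times> 'n) ^ ('n \<times> 'n \<times> 'n)"
    where "m c = (\<chi> x y. case x of (i, j, k) \<Rightarrow>
      block_tangent J c (A y) $ i $ j $ k + E y $ i $ j $ k - block_proj J (E y) $ i $ j $ k)" for c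
  show thesis
  proof (rule that[of "\<lambda>c. det (m c)"])
    have "polynomial_fun (\<lambda>c. block_tangent J c B $ i $ j $ k)" for B i j k
      by (cases "i \<in> J \<or> j \<in> J \<or> k \<notin> J")
        (auto simp: block_tangent_def intro!: polynomial_fun.intros polynomial_fun_sum)
    then have "polynomial_fun (\<lambda>c. m c $ x $ y)" for x y
      by (cases x) (auto simp: m_def diff_conv_add_uminus simp del: add_uminus_conv_diff
          intro!: polynomial_fun.intros)
    then show "polynomial_fun (\<lambda>c. det (m c))"
      using polynomial_fun.det[of m] by simp
    have "m c\<^sub>0 = mat 1"
      by (auto simp: vec_eq_iff m_def A E_def mat_def)
    then show "det (m c\<^sub>0) \<noteq> 0"
      by simp
  next
    fix c assume c: "c \<in> block_space J" and D: "det (m c) \<noteq> 0"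
    \<comment> \<open>Adding the complementary component lets the open mapping theorem be applied in
      the full space instead of a subspace.\<close>
    define \<Psi> where "\<Psi> x = block_act J c (fst x) + (snd x - block_proj J (snd x))" for x
    define \<Psi>' where "\<Psi>' x = block_tangent J c (fst x) + (snd x - block_proj J (snd x))" for x
    have lin: "bounded_linear (\<lambda>v :: 'n structure_constants. v - block_proj J v)"
      by (intro linear_conv_bounded_linear[THEN iffD1] linearI)
        (simp_all add: block_proj_add block_proj_scaleR scaleR_diff_right)
    have der: "(\<Psi> has_derivative \<Psi>') (at (mat 1, 0))"
      unfolding \<Psi>_def \<Psi>'_def
      by (intro has_derivative_add
          has_derivative_compose[OF has_derivative_fst[OF has_derivative_ident]]
          bounded_linear_imp_has_derivative bounded_linear_compose[OF lin] bounded_linear_snd)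
        (simp add: has_derivative_block_act)
    \<comment> \<open>Solving a linear system with the invertible matrix \<open>m c\<close> gives
      coefficients that combine the \<open>A y\<close> and the \<open>E y\<close> into a preimage of
      \<open>v\<close>.\<close>
    have "\<exists>x. \<Psi>' x = v" for v
    proof -
      obtain B where "m c ** B = mat 1"
        using D by (auto simp: invertible_right_inverse simp flip: invertible_det_nz)
      define u where "u = B *v vec_lambda (\<lambda>(i, j, k). v $ i $ j $ k)"
      have "m c *v u = vec_lambda (\<lambda>(i, j, k). v $ i $ j $ k)"
        by (simp add: u_def matrix_vector_mul_assoc \<open>m c ** B = mat 1\<close>)
      then have u: "(\<Sum>y\<in>UNIV. m c $ (i, j, k) $ y * u $ y) = v $ i $ j $ k" for i j k
        by (simp add: vec_eq_iff matrix_vector_mult_def)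
      have "\<Psi>' (\<chi> a b. \<Sum>y\<in>UNIV. u $ y * A y $ a $ b, \<chi> a b d. \<Sum>y\<in>UNIV. u $ y * E y $ a $ b $ d)
          $ i $ j $ k = v $ i $ j $ k" for i j k
        unfolding \<Psi>'_def fst_conv snd_conv vector_add_component vector_minus_component
          block_tangent_sum block_proj_sum vec_lambda_beta u[symmetric]
        by (simp add: m_def algebra_simps sum.distrib sum_subtractf)
      then show ?thesis
        unfolding vec_eq_iff by blast
    qed
    then have "surj \<Psi>'"
      by (metis surjI)
    moreover have "linear \<Psi>'"
      using der by (intro bounded_linear.linear has_derivative_bounded_linear)
    ultimately obtain \<Phi> where "linear \<Phi>" "\<Psi>' \<circ> \<Phi> = id"
      using linear_surjective_right_inverse by blast
    then have \<Phi>: "bounded_linear \<Phi>" "\<Psi>' \<circ> \<Phi> = id"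
      by (simp_all add: linear_conv_bounded_linear)
    \<comment> \<open>An open neighbourhood of the identity on which \<open>block_act J c\<close>
      takes values in the orbit.\<close>
    define T where "T = {M. det (diagonal_block J M) \<noteq> 0 \<and> det (diagonal_block (- J) M) \<noteq> 0}"
    have cont: "continuous_on UNIV (\<lambda>M. det (diagonal_block I M))" for I :: "'n set"
    proof -
      have "continuous_on UNIV (\<lambda>M. diagonal_block I M $ i $ j)" for i j
        by (cases "i \<in> I \<and> j \<in> I") (auto simp: diagonal_block_def intro!: continuous_intros)
      then show ?thesis
        unfolding det_def
        by (intro continuous_on_sum continuous_on_mult continuous_on_const continuous_on_prod)
    qed
    have "open T"
      unfolding T_def
      by (intro open_Collect_conj open_Collect_neq cont continuous_on_const)
    have cont\<Psi>: "continuous_on UNIV \<Psi>"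
    proof -
      have "continuous_on UNIV
          (\<lambda>x :: _ \<times> 'n structure_constants. block_act J c (fst x))"
        unfolding block_act_def
      proof (intro continuous_on_vec_lambda)
        fix i j k
        show "continuous_on UNIV (\<lambda>x :: _ \<times> 'n structure_constants. if i \<in> J \<or> j \<in> J \<or> k \<notin> J then 0
            else (\<Sum>p\<in>UNIV. fst x $ k $ p * (\<Sum>a\<in>UNIV. fst x $ a $ i *
              (\<Sum>b\<in>UNIV. fst x $ b $ j * c $ a $ b $ p))))"
          by (cases "i \<in> J \<or> j \<in> J \<or> k \<notin> J") (auto intro!: continuous_intros)
      qed
      moreover have "continuous_on UNIV
          (\<lambda>x :: (complex ^ 'n ^ 'n) \<times> _. snd x - block_proj J (snd x))"
        using bounded_linear_compose[OF lin bounded_linear_snd] by (rule linear_continuous_on)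
      ultimately show ?thesis
        unfolding \<Psi>_def by (intro continuous_on_add)
    qed
    have "\<Psi> (mat 1, 0) \<in> interior (\<Psi> ` (T \<times> UNIV))"
    proof (rule sussmann_open_mapping[OF open_UNIV cont\<Psi> UNIV_I der \<Phi> subset_UNIV])
      have "(mat 1, 0) \<in> T \<times> UNIV"
        by (simp add: T_def diagonal_block_mat_1)
      then show "(mat 1, 0) \<in> interior (T \<times> (UNIV :: 'n structure_constants set))"
        using \<open>open T\<close> by (simp add: interior_open open_Times)
    qed
    moreover have "\<Psi> (mat 1, 0) = c"
      by (simp add: \<Psi>_def block_act_mat_1[OF c] vec_eq_iff block_proj_def)
    ultimately obtain e where e: "e > 0" "ball c e \<subseteq> \<Psi> ` (T \<times> UNIV)"
      unfolding mem_interior by metis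
    show "\<exists>e>0. \<forall>w\<in>block_space J. dist c w < e \<longrightarrow> w \<in> orbit c"
    proof (intro exI[of _ e] conjI ballI impI e(1))
      fix w assume w: "w \<in> block_space J" "dist c w < e"
      then have "w \<in> \<Psi> ` (T \<times> UNIV)"
        using e(2) by auto
      then obtain M v where M: "M \<in> T" "w = block_act J c M + (v - block_proj J v)"
        by (auto simp: \<Psi>_def)
      \<comment> \<open>Projecting onto the block space removes the complementary component and
        leaves a point of the orbit.\<close>
      have "w = block_proj J w"
        using w(1) by (simp add: block_proj_id)
      also have "\<dots> = block_act J c M"
        by (simp add: M(2) block_proj_add block_proj_diff block_proj_id[OF block_act_skew[OF c]]
            block_proj_id[OF block_proj_in])
      finally show "w \<in> orbit c"
        using M(1) block_act_in_orbit[OF c] by (simp add: T_def invertible_det_nz)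
    qed
  qed
qed

lemma line_block_space:
  assumes "c \<in> block_space J" "c' \<in> block_space J"
  shows "(\<chi> i j k. c $ i $ j $ k + t * (c' $ i $ j $ k - c $ i $ j $ k)) \<in> block_space J"
proof -
  have "c $ i $ j $ k + t * (c' $ i $ j $ k - c $ i $ j $ k) =
      - (c $ j $ i $ k + t * (c' $ j $ i $ k - c $ j $ i $ k))" for i j k
    unfolding block_space_skew[OF assms(1), of i j] block_space_skew[OF assms(2), of i j]
    by (simp add: algebra_simps)
  moreover have "c $ i $ j $ k + t * (c' $ i $ j $ k - c $ i $ j $ k) = 0"
    if "i \<in> J \<or> j \<in> J \<or> k \<notin> J" for i j k
    by (simp add: block_space_zero[OF assms(1) that] block_space_zero[OF assms(2) that])
  ultimately show ?thesis
    unfolding block_space_def mem_Collect_eq vec_lambda_beta by blast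
qed

text \<open>Orbits are open in the set where \<open>D\<close> does not vanish, and a complex line minus finitely many
  points is connected.\<close>

lemma nonzero_subset_orbit:
  assumes D: "polynomial_fun D"
    and nbh: "\<And>c. c \<in> block_space J \<Longrightarrow> D c \<noteq> 0 \<Longrightarrow>
      \<exists>e>0. \<forall>w\<in>block_space J. dist c w < e \<longrightarrow> w \<in> orbit c"
    and c0: "c\<^sub>0 \<in> block_space J" "D c\<^sub>0 \<noteq> 0" and c: "c \<in> block_space J" "D c \<noteq> 0"
  shows "c \<in> orbit c\<^sub>0"
proof -
  define \<gamma> where "\<gamma> t = (\<chi> i j k. c\<^sub>0 $ i $ j $ k + t * (c $ i $ j $ k - c\<^sub>0 $ i $ j $ k))" for t
  have \<gamma>: "\<gamma> t \<in> block_space J" for t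
    unfolding \<gamma>_def by (rule line_block_space[OF c0(1) c(1)])
  have \<gamma>01: "\<gamma> 0 = c\<^sub>0" "\<gamma> 1 = c"
    by (simp_all add: \<gamma>_def vec_eq_iff)
  have "(\<lambda>t. D (\<gamma> t)) \<in> range poly"
    by (rule poly.polynomial_fun_comp[OF D]) (simp add: \<gamma>_def line_in_range_poly)
  then obtain d where d: "\<And>t. D (\<gamma> t) = poly d t"
    by (metis imageE)
  define S where "S = - {t. poly d t = 0}"
  have "d \<noteq> 0"
    using c0(2) d[of 0] \<gamma>01(1) by auto
  then have "connected S"
    unfolding S_def
    by (intro path_connected_imp_connected path_connected_complement_countable
        countable_finite poly_roots_finite) simp_all
  then have "\<gamma> 1 \<in> orbit (\<gamma> 0)"
  proof (rule connected_equivalence_relation[where R = "\<lambda>s t. \<gamma> t \<in> orbit (\<gamma> s)"])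
    show "0 \<in> S" "1 \<in> S"
      using c0(2) c(2) by (simp_all add: S_def \<gamma>01 flip: d)
    fix s assume "s \<in> S"
    then obtain e where e: "e > 0" "\<And>w. w \<in> block_space J \<Longrightarrow> dist (\<gamma> s) w < e \<Longrightarrow> w \<in> orbit (\<gamma> s)"
      using nbh[OF \<gamma>, of s] by (auto simp: S_def d)
    have "continuous_on UNIV \<gamma>"
      unfolding \<gamma>_def by (intro continuous_intros)
    then have "open (\<gamma> -` ball (\<gamma> s) e)"
      by (simp add: open_vimage)
    then have "openin (top_of_set S) (S \<inter> \<gamma> -` ball (\<gamma> s) e)"
      by (simp add: openin_open_Int)
    then show "\<exists>T. openin (top_of_set S) T \<and> s \<in> T \<and> (\<forall>t\<in>T. \<gamma> t \<in> orbit (\<gamma> s))"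
      using \<open>s \<in> S\<close> e \<gamma> by (intro exI[of _ "S \<inter> \<gamma> -` ball (\<gamma> s) e"]) auto
  qed (auto intro: orbit_sym orbit_trans)
  then show ?thesis
    by (simp add: \<gamma>01)
qed

text \<open>On the line from \<open>c\<^sub>0\<close> to a point of the block space,
  \<open>D\<close> is a polynomial in \<open>t\<close> that is nonzero at 0. A polynomial vanishing
  on the orbit therefore vanishes on the line after multiplication by a nonzero polynomial, hence on
  the whole line.\<close>

lemma block_space_subset_closure_of_orbit:
  assumes D: "polynomial_fun D" and c0: "c\<^sub>0 \<in> block_space J" "D c\<^sub>0 \<noteq> 0"
    and orb: "\<And>c. c \<in> block_space J \<Longrightarrow> D c \<noteq> 0 \<Longrightarrow> c \<in> orbit c\<^sub>0"
  shows "block_space J \<subseteq> zariski closure_of (orbit c\<^sub>0)"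
proof
  fix c assume c: "c \<in> block_space J"
  define \<gamma> where "\<gamma> t = (\<chi> i j k. c\<^sub>0 $ i $ j $ k + t * (c $ i $ j $ k - c\<^sub>0 $ i $ j $ k))" for t
  have \<gamma>: "\<gamma> t \<in> block_space J" for t
    unfolding \<gamma>_def by (rule line_block_space[OF c0(1) c])
  have \<gamma>01: "\<gamma> 0 = c\<^sub>0" "\<gamma> 1 = c"
    by (simp_all add: \<gamma>_def vec_eq_iff)
  have *: "\<exists>q. \<forall>t. p (\<gamma> t) = poly q t" if that:  "polynomial_fun p" for p
  proof -
    have "(\<lambda>t. p (\<gamma> t)) \<in> range poly"
      by (rule poly.polynomial_fun_comp[OF that]) (simp add: \<gamma>_def line_in_range_poly)
    then show ?thesis
      by (metis imageE)
  qed
  obtain d where d: "\<And>t. D (\<gamma> t) = poly d t"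
    using *[OF D] by blast
  obtain P where P: "\<And>p. p \<in> P \<Longrightarrow> polynomial_fun p"
    "zariski closure_of (orbit c\<^sub>0) = zero_locus P"
    using closedin_closure_of[of zariski "orbit c\<^sub>0"]
    unfolding closedin_zariski algebraic_set_def by blast
  have "p c = 0" if p: "p \<in> P" for p
  proof -
    obtain q where q: "\<And>t. p (\<gamma> t) = poly q t"
      using *[OF P(1)[OF p]] by blast
    have "poly (q * d) t = 0" for t
    proof (cases "poly d t = 0")
      case False
      then have "\<gamma> t \<in> orbit c\<^sub>0"
        by (intro orb \<gamma>) (simp add: d)
      then have "\<gamma> t \<in> zero_locus P"
        using P(2) closure_of_subset[of "orbit c\<^sub>0" zariski] by auto
      then show ?thesis
        using that by (simp add: zero_locus_def flip: q)
    qed simp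
    then have "q * d = 0"
      using poly_all_0_iff_0 by blast
    moreover have "d \<noteq> 0"
      using c0(2) d[of 0] \<gamma>01(1) by auto
    ultimately show ?thesis
      using q[of 1] by (simp add: \<gamma>01)
  qed
  then show "c \<in> zariski closure_of (orbit c\<^sub>0)"
    by (simp add: P(2) zero_locus_def)
qed

section \<open>Rigidity\<close>

text \<open>Near \<open>c\<^sub>0\<close> the brackets \<open>[x\<^bsub>\<sigma> l\<^esub>, x\<^bsub>\<tau> l\<^esub>]\<close> complete the basis vectors outside \<open>J\<close> to a
  basis, and the matrix of the coefficients of \<open>x\<^bsub>\<beta> i'\<^esub>\<close> in \<open>[x\<^sub>i, x\<^bsub>\<alpha> i'\<^esub>]\<close> is invertible, which
  forces the centre to be spanned by these brackets. In the new basis a structure lies in the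
  block space.\<close>

lemma rigid_in_two_step_nilpotentI:
  fixes c\<^sub>0 :: "'n::finite structure_constants"
  assumes c0: "c\<^sub>0 \<in> block_space J"
    and D: "polynomial_fun D" "D c\<^sub>0 \<noteq> 0"
    and orb: "\<And>c. c \<in> block_space J \<Longrightarrow> D c \<noteq> 0 \<Longrightarrow> c \<in> orbit c\<^sub>0"
    and pairs: "\<And>l. l \<in> J \<Longrightarrow> c\<^sub>0 $ \<sigma> l $ \<tau> l = axis l 1"
    and rows: "\<And>i i'. i \<notin> J \<Longrightarrow> i' \<notin> J \<Longrightarrow> c\<^sub>0 $ i $ \<alpha> i' $ \<beta> i' = (if i = i' then s i else 0)"
    and s: "\<And>i. i \<notin> J \<Longrightarrow> s i \<noteq> 0"
  shows "rigid_in two_step_nilpotent c\<^sub>0"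
proof -
  have c0N: "c\<^sub>0 \<in> two_step_nilpotent"
    using c0 block_space_subset by blast
  define g where "g c = (\<chi> k l. if l \<in> J then c $ \<sigma> l $ \<tau> l $ k else mat 1 $ k $ l)"
    for c :: "'n structure_constants"
  \<comment> \<open>The rows are scaled by the inverse of \<open>s\<close> and completed by the
    identity, so that \<open>Q\<close> is the identity matrix at \<open>c\<^sub>0\<close>.\<close>
  define Q where "Q c = (\<chi> i' i. if i \<in> J \<or> i' \<in> J then mat 1 $ i' $ i
      else inverse (s i') * c $ i $ \<alpha> i' $ \<beta> i')" for c :: "'n structure_constants"
  have g_poly: "(\<lambda>c. g c $ i $ j) \<in> Collect polynomial_fun" for i j
    by (cases "j \<in> J") (auto simp: g_def intro: polynomial_fun.intros)
  have Q_poly: "(\<lambda>c. Q c $ i $ j) \<in> Collect polynomial_fun" for i j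
    by (cases "j \<in> J \<or> i \<in> J") (auto simp: Q_def intro: polynomial_fun.intros)
  have g0: "g c\<^sub>0 = mat 1"
    by (auto simp: vec_eq_iff g_def pairs axis_def mat_def)
  have Q0: "Q c\<^sub>0 = mat 1"
    by (auto simp: vec_eq_iff Q_def rows s mat_def)
  \<comment> \<open>The condition that \<open>D\<close> does not vanish at the moved structure
    becomes polynomial in \<open>c\<close> once powers of \<open>det (g c)\<close> are
    cleared.\<close>
  obtain N q where q: "polynomial_fun q" "\<And>c. det (g c) \<noteq> 0 \<Longrightarrow>
      D (change_basis (matrix_inv (g c)) c) * det (g c) ^ N = q c"
    using polynomial_fun.change_basis_cleared(2)[OF g_poly, of "\<lambda>c. c", OF _ D(1)]
    by (auto intro: polynomial_fun.intros)
  define U where "U = {c. det (g c) * det (Q c) * q c \<noteq> 0}"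
  have "openin zariski U"
    unfolding U_def
    using polynomial_fun.det[OF g_poly] polynomial_fun.det[OF Q_poly] q(1)
    by (intro openin_zariski_nonzero polynomial_fun.intros(4)) simp_all
  moreover have "c\<^sub>0 \<in> U"
  proof -
    have "change_basis (matrix_inv (g c\<^sub>0)) c\<^sub>0 = c\<^sub>0"
      unfolding g0 by (metis change_basis_mat_1 change_basis_matrix_inv(1) invertible_mat_1)
    then show ?thesis
      using q(2)[of c\<^sub>0] D(2) by (simp add: U_def g0 Q0)
  qed
  moreover have "U \<inter> two_step_nilpotent \<subseteq> orbit c\<^sub>0"
  proof
    fix c assume "c \<in> U \<inter> two_step_nilpotent"
    then have U: "det (g c) \<noteq> 0" "det (Q c) \<noteq> 0" "q c \<noteq> 0" and c: "c \<in> two_step_nilpotent"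
      by (auto simp: U_def)
    have inv: "invertible (g c)"
      using U(1) by (simp add: invertible_det_nz)
    define c' where "c' = change_basis (matrix_inv (g c)) c"
    have br: "bracket c' X Y = matrix_inv (g c) *v bracket c (g c *v X) (g c *v Y)" for X Y
      by (simp add: c'_def bracket_change_basis inv matrix_inv_matrix_inv)
    have c'N: "c' \<in> two_step_nilpotent"
      unfolding c'_def by (intro change_basis_two_step_nilpotent invertible_matrix_inv inv c)
    have central: "bracket c (bracket c X Y) Z = 0" for X Y Z
      by (subst two_step_nilpotent_skew[OF c])
        (simp add: two_step_nilpotent_bracket_bracket[OF c])
    have g_axis: "g c *v axis l 1 =
        (if l \<in> J then bracket c (axis (\<sigma> l) 1) (axis (\<tau> l) 1) else axis l 1)" for l
      by (simp add: vec_eq_iff matrix_vector_mult_axis bracket_axis g_def)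
        (simp add: mat_def axis_def)
    \<comment> \<open>The new basis vectors indexed by \<open>J\<close> are brackets of
      \<open>c\<close>, hence central.\<close>
    have zero_left: "c' $ i $ j $ k = 0" if "i \<in> J" for i j k
      using that by (simp add: br g_axis central flip: bracket_axis)
    have skew: "c' $ i $ j $ k = - c' $ j $ i $ k" for i j k
      using c'N unfolding two_step_nilpotent_iff by blast
    have zero_right: "c' $ i $ j $ k = 0" if "j \<in> J" for i j k
      using zero_left[OF that] skew[of i j] by simp
    have zero_val: "c' $ i $ j $ k = 0" if "k \<notin> J" for i j k
    proof -
      define X where "X = c' $ i $ j"
      have X: "g c *v X = bracket c (g c *v axis i 1) (g c *v axis j 1)"
        by (simp add: X_def br inv flip: bracket_axis)
      \<comment> \<open>The part of the value outside \<open>J\<close>, which has to vanish. Since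
        \<open>g c *v X\<close> is a bracket and so central, its brackets with the vectors indexed
        by \<open>\<alpha> i'\<close> give the homogeneous system
        \<open>Q c *v X' = 0\<close>.\<close>
      define X' where "X' = (\<chi> l. if l \<in> J then 0 else X $ l)"
      have "Q c *v X' = 0"
      proof -
        have "(Q c *v X') $ i' = 0" for i'
        proof (cases "i' \<in> J")
          case True
          then have "(Q c *v X') $ i' = (\<Sum>l\<in>UNIV. mat 1 $ i' $ l * X' $ l)"
            by (simp add: matrix_vector_mult_def Q_def)
          also have "\<dots> = 0"
            using True by (simp only: sum_mat_1_left) (simp add: X'_def)
          finally show ?thesis .
        next
          case False
          let ?Y = "axis (\<alpha> i') 1"
          have "0 = bracket c (g c *v X) ?Y"
            by (simp add: X central)
          also have "\<dots> = bracket c (g c *v (\<Sum>l\<in>UNIV. X $ l *s axis l 1)) ?Y"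
            by (simp only: basis_expansion)
          also have "\<dots> = (\<Sum>l\<in>UNIV. X $ l *s bracket c (g c *v axis l 1) ?Y)"
            by (simp only: vec.sum vec.scale vec.linear_sum[OF linear_bracket_left]
                vec.linear_scale[OF linear_bracket_left])
          also have "\<dots> = (\<Sum>l\<in>UNIV. X' $ l *s c $ l $ \<alpha> i')"
            by (intro sum.cong refl, unfold g_axis X'_def)
              (simp add: central, simp add: bracket_axis)
          finally have "0 = (\<Sum>l\<in>UNIV. X' $ l *s c $ l $ \<alpha> i') $ \<beta> i'"
            by simp
          then have 0: "(\<Sum>l\<in>UNIV. X' $ l * c $ l $ \<alpha> i' $ \<beta> i') = 0"
            by simp
          have "(Q c *v X') $ i' = (\<Sum>l\<in>UNIV. inverse (s i') * (X' $ l * c $ l $ \<alpha> i' $ \<beta> i'))"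
            unfolding matrix_vector_mult_def vec_lambda_beta
            by (intro sum.cong refl) (use False in \<open>auto simp: Q_def X'_def\<close>)
          also have "\<dots> = 0"
            by (simp add: 0 flip: sum_distrib_left)
          finally show ?thesis .
        qed
        then show ?thesis
          by (simp add: vec_eq_iff)
      qed
      then have "X' = 0"
        using U(2) inj_matrix_vector_mult[of "Q c"]
        by (metis injD invertible_det_nz matrix_vector_mult_0_right)
      then have "X' $ k = 0"
        by simp
      then show ?thesis
        using that by (simp add: X'_def X_def)
    qed
    have "c' \<in> block_space J"
      unfolding block_space_def using skew zero_left zero_right zero_val by blast
    moreover have "D c' \<noteq> 0"
      using q(2)[OF U(1)] U by (auto simp: c'_def)
    ultimately have "c' \<in> orbit c\<^sub>0"
      by (rule orb)
    moreover have "c \<in> orbit c'"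
      unfolding c'_def by (intro orbit_sym[OF change_basis_in_orbit] invertible_matrix_inv inv)
    ultimately show "c \<in> orbit c\<^sub>0"
      using orbit_trans by blast
  qed
  ultimately have "openin (subtopology zariski two_step_nilpotent) (orbit c\<^sub>0)"
    by (intro openin_orbitI orbit_subset_two_step_nilpotent c0N change_basis_two_step_nilpotent)
  then show ?thesis
    using c0N by (simp add: rigid_in_def)
qed

section \<open>Bringing a structure into a block space\<close>

definition center :: "'n::finite structure_constants \<Rightarrow> (complex ^ 'n) set" where
  "center c = {X. \<forall>Y. bracket c X Y = 0}"

abbreviation derived :: "'n::finite structure_constants \<Rightarrow> (complex ^ 'n) set" where
  "derived c \<equiv> bracket_space c UNIV UNIV"

lemma subspace_center: "vec.subspace (center c)"
  by (auto simp: vec.subspace_def center_def bracket_add_left bracket_scale_left)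

lemma bracket_in_derived: "bracket c X Y \<in> derived c"
  unfolding bracket_space_def by (rule vec.span_base) blast

lemma derived_subset:
  assumes "vec.subspace V" "\<And>X Y. bracket c X Y \<in> V"
  shows "derived c \<subseteq> V"
  unfolding bracket_space_def using assms by (intro vec.span_minimal) auto

lemma derived_subset_center:
  assumes "c \<in> two_step_nilpotent"
  shows "derived c \<subseteq> center c"
proof (rule derived_subset[OF subspace_center])
  have "bracket c (bracket c X Y) Z = 0" for X Y Z
    by (subst two_step_nilpotent_skew[OF assms])
      (simp add: two_step_nilpotent_bracket_bracket[OF assms])
  then show "bracket c X Y \<in> center c" for X Y
    by (simp add: center_def)
qed

text \<open>The set \<open>S\<close> is extended to a basis of the whole space, and the basis is
  indexed so that \<open>J\<close> labels \<open>S\<close>. Centrality of \<open>S\<close> kills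
  arguments in \<open>J\<close>, and the span condition confines the values to
  \<open>J\<close>.\<close>

lemma change_basis_in_block_space:
  fixes c :: "'n::finite structure_constants"
  assumes c: "c \<in> two_step_nilpotent" and S: "S \<subseteq> center c" "derived c \<subseteq> vec.span S"
    and ind: "vec.independent S" and card: "card S = card J"
  obtains g where "invertible g" "change_basis g c \<in> block_space J"
    "\<And>j. j \<in> J \<Longrightarrow> matrix_inv g *v axis j 1 \<in> S"
proof -
  obtain B where B: "S \<subseteq> B" "vec.independent B" "UNIV \<subseteq> vec.span B"
    by (rule vec.maximal_independent_subset_extend[OF subset_UNIV ind])
  have fin: "finite B"
    using B(2) by (rule vec.finiteI_independent)
  have "card B = CARD('n)"
    using vec.basis_card_eq_dim[OF subset_UNIV B(3) B(2)] vec_dim_card by metis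
  then have "card (B - S) = card (- J)"
    using card B(1) fin by (simp add: card_Diff_subset finite_subset Compl_eq_Diff_UNIV)
  then obtain f2 where f2: "bij_betw f2 (- J) (B - S)"
    using finite_same_card_bij[of "- J" "B - S"] fin by auto
  obtain f1 where f1: "bij_betw f1 J S"
    using finite_same_card_bij[of J S] card fin B(1) finite_subset by auto
  define f where "f l = (if l \<in> J then f1 l else f2 l)" for l
  have fJ: "f l \<in> S" if "l \<in> J" for l
    using that f1 by (auto simp: f_def bij_betw_def)
  have SJ: "S = f ` J"
    using f1 by (auto simp: f_def bij_betw_def)
  have "range f = B"
  proof -
    have "range f = f ` J \<union> f ` (- J)"
      by auto
    also have "f ` (- J) = B - S"
      using f2 by (auto simp: f_def bij_betw_def image_iff)
    finally show ?thesis
      using SJ B(1) by blast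
  qed
  define h where "h = (\<chi> k l. f l $ k)"
  have h_axis: "h *v axis l 1 = f l" for l
    by (simp add: vec_eq_iff matrix_vector_mult_axis h_def)
  have "columns h = B"
    using \<open>range f = B\<close> by (auto simp: columns_def column_def h_def)
  then have inv: "invertible h"
    using B(3) matrix_right_invertible_span_columns[of h] by (auto simp: invertible_right_inverse)
  let ?c = "change_basis (matrix_inv h) c"
  have br: "bracket ?c X Y = matrix_inv h *v bracket c (h *v X) (h *v Y)" for X Y
    by (simp add: bracket_change_basis inv matrix_inv_matrix_inv)
  have skew: "?c $ i $ j $ k = - ?c $ j $ i $ k" for i j k
    using change_basis_two_step_nilpotent[OF invertible_matrix_inv[OF inv] c]
    unfolding two_step_nilpotent_iff by blast
  have left: "?c $ i $ j $ k = 0" if "i \<in> J" for i j k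
  proof -
    have "h *v axis i 1 \<in> center c"
      using fJ[OF that] S(1) by (auto simp: h_axis)
    then have "bracket ?c (axis i 1) (axis j 1) = 0"
      by (simp add: br center_def)
    then show ?thesis
      by (simp add: bracket_axis)
  qed
  have "?c $ i $ j $ k = 0" if ijk: "i \<in> J \<or> j \<in> J \<or> k \<notin> J" for i j k
  proof -
    consider "i \<in> J" | "j \<in> J" | "k \<notin> J"
      using ijk by blast
    then show ?thesis
    proof cases
      case 2
      then show ?thesis
        using skew[of i j k] left[of j i k] by simp
    next
      case 3
      have "(matrix_inv h *v W) $ k = 0" if "W \<in> vec.span S" for W
        using that
      proof (induction rule: vec.span_induct_alt)
        case (step a x y)
        then obtain l where l: "l \<in> J" "x = h *v axis l 1"
          by (auto simp: SJ h_axis)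
        then have "(matrix_inv h *v x) $ k = 0"
          using 3 by (auto simp: inv axis_def)
        then show ?case
          using step by (simp add: matrix_vector_right_distrib vector_scalar_commute)
      qed simp
      moreover have "bracket c (h *v axis i 1) (h *v axis j 1) \<in> vec.span S"
        using S(2) bracket_in_derived by blast
      ultimately have "bracket ?c (axis i 1) (axis j 1) $ k = 0"
        by (simp add: br)
      then show ?thesis
        by (simp add: bracket_axis)
    qed (rule left)
  qed
  then have "?c \<in> block_space J"
    unfolding block_space_def using skew by blast
  moreover have "matrix_inv (matrix_inv h) *v axis j 1 \<in> S" if "j \<in> J" for j
    using fJ[OF that] by (simp add: matrix_inv_matrix_inv inv h_axis)
  ultimately show thesis
    using that invertible_matrix_inv[OF inv] by blast
qed

text \<open>A basis of the derived algebra extends to a basis of the centre; a set of exactly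
  \<open>card J\<close> vectors between the two bases serves as \<open>S\<close>.\<close>

lemma block_space_representative:
  fixes c :: "'n::finite structure_constants"
  assumes c: "c \<in> two_step_nilpotent"
    and J: "vec.dim (derived c) \<le> card J" "card J \<le> vec.dim (center c)"
  obtains g where "invertible g" "change_basis g c \<in> block_space J"
proof -
  obtain A where A: "A \<subseteq> derived c" "vec.independent A" "derived c \<subseteq> vec.span A"
    "card A = vec.dim (derived c)"
    by (rule vec.basis_exists)
  obtain B where B: "A \<subseteq> B" "B \<subseteq> center c" "vec.independent B" "center c \<subseteq> vec.span B"
    by (rule vec.maximal_independent_subset_extend
        [OF subset_trans[OF A(1) derived_subset_center[OF c]] A(2)])
  have "card B = vec.dim (center c)" "finite B"
    using vec.basis_card_eq_dim[of B "center c"] B vec.finiteI_independent by blast+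
  then obtain S where S: "A \<subseteq> S" "S \<subseteq> B" "card S = card J"
    using exists_subset_between[of A "card J" B] J A(4) B(1) by auto
  have "S \<subseteq> center c"
    using S(2) B(2) by blast
  moreover have "derived c \<subseteq> vec.span S"
    using A(3) vec.span_mono[OF S(1)] by blast
  moreover have "vec.independent S"
    using vec.independent_mono[OF B(3) S(2)] .
  ultimately show thesis
    using change_basis_in_block_space[OF c _ _ _ S(3)] that by metis
qed

text \<open>If the derived algebra is a line, the bracket is a skew form which is degenerate along it,
  so the form lives on an odd-dimensional space and has a further null vector.\<close>

lemma dim_center_ge_2:
  fixes c :: "'n::finite structure_constants"
  assumes c: "c \<in> two_step_nilpotent" and even: "even CARD('n)"
  shows "vec.dim (center c) \<ge> 2"
proof (rule ccontr)
  assume "\<not> ?thesis"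
  then have dim: "vec.dim (center c) \<le> 1"
    by simp
  have "CARD('n) \<noteq> 0"
    by simp
  with even have card: "CARD('n) \<ge> 2"
    by (metis One_nat_def Suc_1 Suc_leI less_Suc0 linorder_not_le nat_less_le odd_one)
  obtain j :: 'n where True
    by simp
  have derived1: "vec.dim (derived c) \<le> card {j}"
    using vec.dim_subset[OF derived_subset_center[OF c]] dim by simp
  \<comment> \<open>With trivial centre all brackets would vanish, and the centre would be
    everything.\<close>
  have "vec.dim (center c) \<noteq> 0"
  proof
    assume 0: "vec.dim (center c) = 0"
    then have "center c \<subseteq> {0}"
      by (simp add: vec.dim_eq_0)
    then have "bracket c X Y = 0" for X Y
      using bracket_in_derived[of c X Y] derived_subset_center[OF c] by blast
    then have "center c = UNIV"
      by (auto simp: center_def)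
    then show False
      using 0 card vec_dim_card[where 'a = complex and 'n = 'n] by simp
  qed
  then have "card {j} \<le> vec.dim (center c)"
    unfolding card_1_singleton_iff[THEN iffD2, OF exI, OF refl] by linarith
  then obtain g where g: "invertible g" "change_basis g c \<in> block_space {j}"
    by (rule block_space_representative[OF c derived1])
  let ?c = "change_basis g c"
  define s :: "'n \<Rightarrow> complex" where "s i = (if i = j then 1 else - 1)" for i
  \<comment> \<open>The matrix of the skew form, with 1 placed in the diagonal entry at
    \<open>j\<close>. Transposition negates all rows except row \<open>j\<close>; their number is
    odd, so \<open>det M = - det M\<close>.\<close>
  define M where "M = (\<chi> a b. ?c $ a $ b $ j + (if a = j \<and> b = j then 1 else 0))"
  have "transpose M = (\<chi> a. s a *s M $ a)"
  proof -
    have "M $ b $ a = s a * M $ a $ b" for a b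
      using block_space_skew[OF g(2), of b a j] block_space_zero[OF g(2)]
      by (auto simp: M_def s_def)
    then show ?thesis
      unfolding vec_eq_iff transpose_def vec_lambda_beta vector_smult_component by blast
  qed
  then have "det M = det (\<chi> a. s a *s M $ a)"
    by (metis det_transpose)
  also have "\<dots> = prod s UNIV * det M"
    by (simp add: det_rows_mul)
  also have "prod s UNIV = - 1"
  proof -
    have "prod s UNIV = s j * prod s (UNIV - {j})"
      by (rule prod.remove) auto
    also have "prod s (UNIV - {j}) = (\<Prod>i\<in>UNIV - {j}. - 1)"
      by (rule prod.cong) (auto simp: s_def)
    finally show ?thesis
      using even card by (simp add: s_def card_Diff_singleton)
  qed
  finally have "det M = 0"
    by simp
  then have "\<not> (\<exists>B. B ** M = mat 1)"
    by (simp add: invertible_det_nz flip: invertible_left_inverse)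
  then obtain X where X: "M *v X = 0" "X \<noteq> 0"
    unfolding matrix_left_invertible_ker by blast
  have M_mult: "(M *v X) $ a = (\<Sum>b\<in>UNIV. ?c $ a $ b $ j * X $ b) +
      (if a = j then X $ j else 0)" for a
    by (simp add: M_def matrix_vector_mult_def distrib_right sum.distrib if_distrib[of "\<lambda>x. x * _"]
        cong: if_cong)
  \<comment> \<open>Row \<open>j\<close> of \<open>M\<close> reads off the coordinate at
    \<open>j\<close>, so the kernel vector is independent of \<open>axis j 1\<close>.\<close>
  have Xj: "X $ j = 0"
    using M_mult[of j] X(1) block_space_zero[OF g(2)] by simp
  have null: "(\<Sum>b\<in>UNIV. ?c $ a $ b $ j * X $ b) = 0" for a
    using M_mult[of a] X(1) Xj by (simp split: if_splits)
  have "bracket ?c X Y $ k = 0" for Y k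
  proof (cases "k = j")
    case True
    have "bracket ?c X Y $ j = - bracket ?c Y X $ j"
      by (subst two_step_nilpotent_skew[OF change_basis_two_step_nilpotent[OF g(1) c]]) simp
    also have "bracket ?c Y X $ j = (\<Sum>a\<in>UNIV. Y $ a * (\<Sum>b\<in>UNIV. ?c $ a $ b $ j * X $ b))"
      by (simp add: bracket_nth sum_distrib_left mult_ac)
    finally show ?thesis
      by (simp only: True null) simp
  qed (simp add: bracket_nth block_space_zero[OF g(2)])
  then have brX: "bracket ?c X Y = 0" for Y
    by (simp add: vec_eq_iff)
  have brj: "bracket ?c (axis j 1) Y = 0" for Y
    by (subst bracket_block_cong[OF g(2), of _ 0 Y Y]) (auto simp: axis_def)
  have pull: "matrix_inv g *v W \<in> center c" if "\<And>Y. bracket ?c W Y = 0" for W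
  proof -
    have "bracket c (matrix_inv g *v W) Y = 0" for Y
    proof -
      have "g *v bracket c (matrix_inv g *v W) Y = 0"
        using that[of "g *v Y"] by (simp add: bracket_change_basis g(1))
      then show ?thesis
        by (metis g(1) matrix_inv_mult_vector(2) matrix_vector_mult_0_right)
    qed
    then show ?thesis
      by (simp add: center_def)
  qed
  have "vec.independent {X, axis j 1}"
  proof -
    have "X \<notin> vec.span {axis j 1}"
    proof
      assume "X \<in> vec.span {axis j 1}"
      then obtain a where "X = a *s axis j 1"
        by (auto simp: vec.span_singleton)
      then show False
        using Xj X(2) by (auto simp: axis_def)
    qed
    moreover have "axis j (1 :: complex) \<noteq> 0"
      by (simp add: axis_eq_0_iff)
    ultimately show ?thesis
      by (simp add: vec.independent_insert)
  qed
  moreover have inj: "inj_on ((*v) (matrix_inv g)) A" for A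
    using inj_matrix_vector_mult[OF invertible_matrix_inv[OF g(1)]] by (rule inj_on_subset) simp
  ultimately have "vec.independent ((*v) (matrix_inv g) ` {X, axis j 1})"
    by (rule vec.independent_injective_image)
  then have "card ((*v) (matrix_inv g) ` {X, axis j 1}) \<le> vec.dim (center c)"
    by (rule vec.independent_card_le_dim[rotated]) (auto intro!: pull brX brj)
  moreover have "card ((*v) (matrix_inv g) ` {X, axis j 1}) = 2"
  proof -
    have "X \<noteq> axis j 1"
      using Xj by (auto simp: axis_def)
    then show ?thesis
      by (simp only: card_image[OF inj]) simp
  qed
  ultimately show False
    using dim by simp
qed

text \<open>Modulo the centre at most three generators remain, and a skew bracket on three vectors
  is determined by three values.\<close>

lemma dim_derived_le_3:
  fixes c :: "'n::finite structure_constants"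
  assumes c: "c \<in> two_step_nilpotent" and dim: "CARD('n) \<le> vec.dim (center c) + 3"
  shows "vec.dim (derived c) \<le> 3"
proof -
  obtain A where A: "A \<subseteq> center c" "vec.independent A" "center c \<subseteq> vec.span A"
    "card A = vec.dim (center c)"
    by (rule vec.basis_exists)
  obtain B where B: "A \<subseteq> B" "vec.independent B" "UNIV \<subseteq> vec.span B"
    by (rule vec.maximal_independent_subset_extend[OF subset_UNIV A(2)])
  have "card B = CARD('n)" "finite B"
    using vec.basis_card_eq_dim[OF subset_UNIV B(3) B(2)]
      vec_dim_card[where 'a = complex and 'n = 'n] vec.finiteI_independent[OF B(2)] by auto
  then have "card (B - A) \<le> 3"
    using dim A(4) B(1) by (simp add: card_Diff_subset finite_subset)
  have "\<exists>u v w. B - A \<subseteq> {u, v, w}"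
  proof -
    have "\<exists>u v w. S \<subseteq> {u, v, w}" if S: "finite S" "card S \<le> 3" for S :: "(complex ^ 'n) set"
    proof -
      obtain xs where "set xs = S" "length xs \<le> 3"
        using S finite_distinct_list distinct_card by metis
      then show ?thesis
        \<comment> \<open>For a shorter list an index past the end gives an unspecified vector,
          which is harmless because only an inclusion is claimed.\<close>
        by (intro exI[of _ "xs ! 0"] exI[of _ "xs ! 1"] exI[of _ "xs ! 2"])
          (auto simp: numeral_3_eq_3 numeral_2_eq_2 le_Suc_eq length_Suc_conv)
    qed
    then show ?thesis
      using \<open>finite B\<close> \<open>card (B - A) \<le> 3\<close> by simp
  qed
  then obtain u v w where uvw: "B - A \<subseteq> {u, v, w}"
    by blast
  let ?T = "{bracket c u v, bracket c u w, bracket c v w}"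
  note skew = two_step_nilpotent_skew[OF c]
  have alt: "bracket c x x = 0" for x
    using skew[of x x] by (simp add: vec_eq_iff)
  have "bracket c x y \<in> vec.span ?T" if xy: "x \<in> B" "y \<in> B" for x y
  proof -
    consider "x \<in> center c" | "y \<in> center c" | "x \<in> {u, v, w}" "y \<in> {u, v, w}"
      using xy uvw A(1) by blast
    then show ?thesis
    proof cases
      case 1
      then show ?thesis
        by (simp add: center_def vec.span_zero)
    next
      case 2
      then show ?thesis
        by (subst skew) (simp add: center_def vec.span_zero)
    next
      case 3
      have "bracket c v u \<in> vec.span ?T" "bracket c w u \<in> vec.span ?T" "bracket c w v \<in> vec.span ?T"
        by (subst skew, intro vec.span_neg vec.span_base, simp)+
      then show ?thesis
        using 3 by (auto simp: alt vec.span_zero intro: vec.span_base)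
    qed
  qed
  then have "bracket c x Y \<in> vec.span ?T" if "x \<in> B" for x Y
  proof -
    have "Y \<in> vec.span B"
      using B(3) by blast
    then show ?thesis
      by (induction rule: vec.span_induct_alt)
        (auto simp: bracket_add_right bracket_scale_right that
          \<open>\<And>y x. x \<in> B \<Longrightarrow> y \<in> B \<Longrightarrow> bracket c x y \<in> vec.span ?T\<close>
          intro!: vec.span_add vec.span_scale vec.span_zero)
  qed
  then have "bracket c X Y \<in> vec.span ?T" for X Y
  proof -
    have "X \<in> vec.span B"
      using B(3) by blast
    then show ?thesis
      by (induction rule: vec.span_induct_alt)
        (auto simp: bracket_add_left bracket_scale_left \<open>\<And>Y x. x \<in> B \<Longrightarrow> bracket c x Y \<in> vec.span ?T\<close>
          intro!: vec.span_add vec.span_scale vec.span_zero)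
  qed
  then have "derived c \<subseteq> vec.span ?T"
    by (intro derived_subset vec.subspace_span)
  then have "vec.dim (derived c) \<le> card ?T"
    by (intro vec.dim_le_card) simp_all
  also have "\<dots> \<le> 3"
    by (simp add: card_insert_if)
  finally show ?thesis .
qed

section \<open>Orbit closures as irreducible components\<close>

lemma derived_change_basis_subset:
  "derived (change_basis g c) \<subseteq> (*v) g ` derived c"
proof (rule derived_subset)
  show "vec.subspace ((*v) g ` derived c)"
    unfolding bracket_space_def
    by (intro vec.linear_subspace_image matrix_vector_mul_linear_gen vec.subspace_span)
  show "bracket (change_basis g c) X Y \<in> (*v) g ` derived c" for X Y
    unfolding bracket_change_basis by (intro imageI bracket_in_derived)
qed

text \<open>A change of basis cannot raise the dimension, and it can be reversed. This invariant
  separates the three orbits.\<close>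

lemma dim_derived_orbit:
  assumes "c \<in> orbit c'"
  shows "vec.dim (derived c) = vec.dim (derived c')"
proof -
  have "vec.dim (derived (change_basis g c)) \<le> vec.dim (derived c)"
    for g and c :: "'a structure_constants"
    using vec.dim_subset[OF derived_change_basis_subset]
      vec.dim_image_le[OF matrix_vector_mul_linear_gen] by (rule order_trans)
  then have "vec.dim (derived c) \<le> vec.dim (derived c')"
    if "c \<in> orbit c'" for c c' :: "'a structure_constants"
    using that by (auto simp: orbit_def)
  then show ?thesis
    using assms orbit_sym by (metis order_antisym)
qed

lemma dim_derived_block_space:
  assumes c: "c \<in> block_space J" and pairs: "\<And>l. l \<in> J \<Longrightarrow> c $ \<sigma> l $ \<tau> l = axis l 1"
  shows "vec.dim (derived c) = card J"
proof (rule antisym)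
  let ?B = "(\<lambda>l. axis l (1 :: complex)) ` J"
  have inj: "inj_on (\<lambda>l. axis l (1 :: complex)) J"
    by (auto simp: inj_on_def axis_eq_axis)
  have "bracket c X Y \<in> {x. \<forall>i. i \<notin> J \<longrightarrow> x $ i = 0}" for X Y
    by (simp add: bracket_nth block_space_zero[OF c])
  moreover have "vec.subspace {x :: complex ^ 'a. \<forall>i. i \<notin> J \<longrightarrow> x $ i = 0}"
    by (simp add: vec.subspace_def)
  ultimately have "derived c \<subseteq> {x. \<forall>i. i \<notin> J \<longrightarrow> x $ i = 0}"
    by (intro derived_subset)
  then have "vec.dim (derived c) \<le> vec.dim {x :: complex ^ 'a. \<forall>i. i \<notin> J \<longrightarrow> x $ i = 0}"
    by (rule vec.dim_subset)
  then show "vec.dim (derived c) \<le> card J"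
    by (simp only: dim_substandard_cart)
  have "axis l 1 \<in> derived c" if "l \<in> J" for l
    using bracket_in_derived[of c "axis (\<sigma> l) 1" "axis (\<tau> l) 1"]
    by (simp add: bracket_axis pairs that)
  then have "?B \<subseteq> derived c"
    by blast
  moreover have "vec.independent ?B"
    by (rule vec.independent_mono[OF independent_cart_basis]) (auto simp: cart_basis_def)
  ultimately have "card ?B \<le> vec.dim (derived c)"
    by (rule vec.independent_card_le_dim)
  then show "card J \<le> vec.dim (derived c)"
    by (simp only: card_image[OF inj])
qed

text \<open>One polynomial \<open>D\<close> serves both conclusions. The hypotheses are finite
  computations with the structure constants of \<open>c\<^sub>0\<close>.\<close>

lemma block_space_generic:
  fixes c\<^sub>0 :: "'n::finite structure_constants"
  assumes c0: "c\<^sub>0 \<in> block_space J"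
    and onto: "\<And>w. w \<in> block_space J \<Longrightarrow> \<exists>A. block_tangent J c\<^sub>0 A = w"
    and pairs: "\<And>l. l \<in> J \<Longrightarrow> c\<^sub>0 $ \<sigma> l $ \<tau> l = axis l 1"
    and rows: "\<And>i i'. i \<notin> J \<Longrightarrow> i' \<notin> J \<Longrightarrow> c\<^sub>0 $ i $ \<alpha> i' $ \<beta> i' = (if i = i' then s i else 0)"
    and s: "\<And>i. i \<notin> J \<Longrightarrow> s i \<noteq> 0"
  shows "rigid_in two_step_nilpotent c\<^sub>0" and "block_space J \<subseteq> zariski closure_of (orbit c\<^sub>0)"
proof -
  obtain D where D: "polynomial_fun D" "D c\<^sub>0 \<noteq> 0"
    "\<And>c. c \<in> block_space J \<Longrightarrow> D c \<noteq> 0 \<Longrightarrow> \<exists>e>0. \<forall>w\<in>block_space J. dist c w < e \<longrightarrow> w \<in> orbit c"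
    using open_orbit_in_block_space[of J c\<^sub>0, OF onto] by blast
  have orb: "c \<in> orbit c\<^sub>0" if "c \<in> block_space J" "D c \<noteq> 0" for c
    by (rule nonzero_subset_orbit[OF D(1) D(3) c0 D(2) that])
  show "rigid_in two_step_nilpotent c\<^sub>0"
    by (rule rigid_in_two_step_nilpotentI[OF c0 D(1,2) orb pairs rows s])
  show "block_space J \<subseteq> zariski closure_of (orbit c\<^sub>0)"
    by (rule block_space_subset_closure_of_orbit[OF D(1) c0 D(2) orb])
qed

text \<open>An open set cutting out the orbit of \<open>a\<close> in \<open>N\<close> contains a
  point of the closure of the orbit of \<open>b\<close>, hence meets that orbit; orbits that meet
  coincide.\<close>

lemma rigid_orbit_closure_subset:
  assumes a: "rigid_in N a" and "orbit b \<subseteq> N"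
    and sub: "zariski closure_of (orbit a) \<subseteq> zariski closure_of (orbit b)"
  shows "orbit a = orbit b"
proof -
  obtain U where U: "openin zariski U" "orbit a = U \<inter> N"
    using a by (auto simp: rigid_in_def openin_subtopology)
  have "a \<in> zariski closure_of (orbit a)"
    using closure_of_subset[of "orbit a" zariski] orbit_refl by auto
  then have "a \<in> zariski closure_of (orbit b)"
    using sub by (rule subsetD[rotated])
  moreover have "a \<in> U"
    using U(2) orbit_refl[of a] by auto
  ultimately have "\<exists>x. x \<in> orbit b \<and> x \<in> U"
    using U(1) by (simp add: in_closure_of)
  then obtain x where x: "x \<in> orbit b" "x \<in> U"
    by blast
  then have "x \<in> orbit a"
    using U(2) assms(2) by blast
  then show ?thesis
    using x(1) orbit_eqI by blast
qed

section \<open>The three generic structures in dimension eight\<close>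

lemma exhaust_8: "(x :: 8) = 1 \<or> x = 2 \<or> x = 3 \<or> x = 4 \<or> x = 5 \<or> x = 6 \<or> x = 7 \<or> x = 8"
proof (induct x)
  case (of_int z)
  \<comment> \<open>The representative 0 is the element written 8.\<close>
  then have "z = 0 \<or> z = 1 \<or> z = 2 \<or> z = 3 \<or> z = 4 \<or> z = 5 \<or> z = 6 \<or> z = 7"
    by simp arith
  then show ?case
    by auto
qed

lemma sum_8: "(\<Sum>x :: 8\<in>UNIV. f x) = f 1 + f 2 + f 3 + f 4 + f 5 + f 6 + f 7 + f 8"
proof -
  have "(UNIV :: 8 set) = {1, 2, 3, 4, 5, 6, 7, 8}"
    using exhaust_8 by auto
  then have "sum f UNIV = sum f {1, 2, 3, 4, 5, 6, 7, 8 :: 8}"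
    by (rule arg_cong)
  also have "\<dots> = f 1 + f 2 + f 3 + f 4 + f 5 + f 6 + f 7 + f 8"
    by (simp add: add.assoc)
  finally show ?thesis .
qed

definition vec8 :: "'a \<Rightarrow> 'a \<Rightarrow> 'a \<Rightarrow> 'a \<Rightarrow> 'a \<Rightarrow> 'a \<Rightarrow> 'a \<Rightarrow> 'a \<Rightarrow> 'a ^ 8" where
  "vec8 a b c d e f g h = (\<chi> i. if i = 1 then a else if i = 2 then b else if i = 3 then c
     else if i = 4 then d else if i = 5 then e else if i = 6 then f else if i = 7 then g else h)"

lemma vec8_nth [simp]:
  "vec8 a b c d e f g h $ 1 = a" "vec8 a b c d e f g h $ 2 = b"
  "vec8 a b c d e f g h $ 3 = c" "vec8 a b c d e f g h $ 4 = d"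
  "vec8 a b c d e f g h $ 5 = e" "vec8 a b c d e f g h $ 6 = f"
  "vec8 a b c d e f g h $ 7 = g" "vec8 a b c d e f g h $ 8 = h"
  by (simp_all add: vec8_def)

lemma basis_vec_nth: "basis_vec i $ j = (if j = i then 1 else 0)"
  by (simp add: basis_vec_def axis_def)

lemma from_brackets_Nil: "from_brackets [] $ p $ q = 0"
  by (simp add: from_brackets_def)

lemma from_brackets_Cons:
  "from_brackets ((i, j, v) # L) $ p $ q =
     (if p = i \<and> q = j then v else if p = j \<and> q = i then - v else 0) + from_brackets L $ p $ q"
  by (simp add: from_brackets_def)

lemma from_brackets_in_block_space:
  assumes "\<forall>(i, j, v)\<in>set L. i \<notin> J \<and> j \<notin> J \<and> i \<noteq> j \<and> (\<forall>k. k \<notin> J \<longrightarrow> v $ k = 0)"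
  shows "from_brackets L \<in> block_space J"
  using assms
proof (induction L)
  case Nil
  then show ?case
    by (simp add: block_space_def from_brackets_Nil)
next
  case (Cons x L)
  obtain i j v where x: "x = (i, j, v)"
    by (cases x)
  have IH: "from_brackets L \<in> block_space J"
    using Cons by simp
  have v: "i \<notin> J" "j \<notin> J" "i \<noteq> j" "\<And>k. k \<notin> J \<Longrightarrow> v $ k = 0"
    using Cons.prems by (auto simp: x)
  have "from_brackets (x # L) $ p $ q $ k = - from_brackets (x # L) $ q $ p $ k" for p q k
    using v(3) by (auto simp: x from_brackets_Cons block_space_skew[OF IH, of p q])
  moreover have "from_brackets (x # L) $ p $ q $ k = 0" if "p \<in> J \<or> q \<in> J \<or> k \<notin> J" for p q k
    using that v by (auto simp: x from_brackets_Cons block_space_zero[OF IH])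
  ultimately show ?case
    unfolding block_space_def by blast
qed

lemma block_tangent_in_block_space:
  assumes "c \<in> block_space J"
  shows "block_tangent J c A \<in> block_space J"
proof -
  have "block_tangent J c A $ i $ j $ k = - block_tangent J c A $ j $ i $ k" for i j k
    unfolding block_tangent_def vec_lambda_beta block_space_skew[OF assms, of j]
      block_space_skew[OF assms, of _ i]
    by (simp add: sum_negf)
  moreover have "block_tangent J c A $ i $ j $ k = 0" if "i \<in> J \<or> j \<in> J \<or> k \<notin> J" for i j k
    using that by (simp add: block_tangent_def)
  ultimately show ?thesis
    unfolding block_space_def by blast
qed

text \<open>With \<open>P\<close> meeting every unordered pair of distinct indices outside
  \<open>J\<close>, skew-symmetry reduces equality to a finite list of coordinates.\<close>

lemma block_space_eqI:
  assumes c: "c \<in> block_space J" "c' \<in> block_space J"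
    and P: "\<And>i j. i \<notin> J \<Longrightarrow> j \<notin> J \<Longrightarrow> i = j \<or> (i, j) \<in> P \<or> (j, i) \<in> P"
    and eq: "\<And>i j k. (i, j) \<in> P \<Longrightarrow> k \<in> J \<Longrightarrow> c $ i $ j $ k = c' $ i $ j $ k"
  shows "c = c'"
proof -
  have diag: "b $ i $ i $ k = 0" if "b \<in> block_space J" for b i k
    using block_space_skew[OF that, of i i k] by simp
  have "c $ i $ j $ k = c' $ i $ j $ k" for i j k
  proof (cases "i \<in> J \<or> j \<in> J \<or> k \<notin> J")
    case True
    then show ?thesis
      by (simp add: block_space_zero[OF c(1)] block_space_zero[OF c(2)])
  next
    case False
    then consider "i = j" | "(i, j) \<in> P" | "(j, i) \<in> P"
      using P by blast
    then show ?thesis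
    proof cases
      case 1
      then show ?thesis
        by (simp add: diag c)
    next
      case 2
      then show ?thesis
        using eq False by blast
    next
      case 3
      then have "c $ j $ i $ k = c' $ j $ i $ k"
        using eq False by blast
      then show ?thesis
        using block_space_skew[OF c(1), of i j k] block_space_skew[OF c(2), of i j k] by simp
    qed
  qed
  then show ?thesis
    by (simp add: vec_eq_iff)
qed

section \<open>Two-dimensional derived algebra\<close>

lemma N1_8_2_in_block_space: "N1_8_2 \<in> block_space {7, 8}"
  unfolding N1_8_2_def by (rule from_brackets_in_block_space) (auto simp: basis_vec_nth)

text \<open>The matrices \<open>?A\<close> below solve the linear equations \<open>block_tangent J c A = w\<close>; they were found
  by Gaussian elimination.\<close>

lemma N1_8_2_onto:
  assumes w: "w \<in> block_space {7, 8}"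
  shows "\<exists>A. block_tangent {7, 8} N1_8_2 A = w"
proof
  let ?A = "vec8
      (vec8 (w $ 1 $ 2 $ 7 + w $ 3 $ 4 $ 7 + w $ 5 $ 6 $ 8 - w $ 1 $ 2 $ 8 - w $ 5 $ 6 $ 7) 0
        (- w $ 2 $ 3 $ 7) (- w $ 2 $ 4 $ 7) (w $ 2 $ 5 $ 8 - w $ 2 $ 5 $ 7)
        (w $ 2 $ 6 $ 8 - w $ 2 $ 6 $ 7) 0 0)
      (vec8 0 0 (w $ 1 $ 3 $ 7) (w $ 1 $ 4 $ 7) (w $ 1 $ 5 $ 7 - w $ 1 $ 5 $ 8)
        (w $ 1 $ 6 $ 7 - w $ 1 $ 6 $ 8) 0 0)
      (vec8 (w $ 1 $ 4 $ 8) (w $ 2 $ 4 $ 8) (w $ 3 $ 4 $ 8) 0 (w $ 4 $ 5 $ 7 - w $ 4 $ 5 $ 8)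
        (w $ 4 $ 6 $ 7 - w $ 4 $ 6 $ 8) 0 0)
      (vec8 (- w $ 1 $ 3 $ 8) (- w $ 2 $ 3 $ 8) 0 0 (w $ 3 $ 5 $ 8 - w $ 3 $ 5 $ 7)
        (w $ 3 $ 6 $ 8 - w $ 3 $ 6 $ 7) 0 0)
      (vec8 (w $ 1 $ 6 $ 8) (w $ 2 $ 6 $ 8) (w $ 3 $ 6 $ 7) (w $ 4 $ 6 $ 7)
        (w $ 5 $ 6 $ 8 - w $ 1 $ 2 $ 8) 0 0 0)
      (vec8 (- w $ 1 $ 5 $ 8) (- w $ 2 $ 5 $ 8) (- w $ 3 $ 5 $ 7) (- w $ 4 $ 5 $ 7) 0 0 0 0)
      (vec8 0 0 0 0 0 0 (w $ 1 $ 2 $ 8 + w $ 5 $ 6 $ 7 - w $ 3 $ 4 $ 7 - w $ 5 $ 6 $ 8)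
        (w $ 3 $ 4 $ 7))
      (vec8 0 0 0 0 0 0 (w $ 1 $ 2 $ 8) 0)"
  let ?P = "{(1, 2), (1, 3), (1, 4), (1, 5), (1, 6), (2, 3), (2, 4), (2, 5), (2, 6), (3, 4), (3, 5),
      (3, 6), (4, 5), (4, 6), (5, 6)}"
  show "block_tangent {7, 8} N1_8_2 ?A = w"
  proof (rule block_space_eqI[where P = ?P])
    show "block_tangent {7, 8} N1_8_2 ?A \<in> block_space {7, 8}"
      by (rule block_tangent_in_block_space[OF N1_8_2_in_block_space])
    show "w \<in> block_space {7, 8}"
      by (rule w)
    show "i = j \<or> (i, j) \<in> ?P \<or> (j, i) \<in> ?P"
      if "i \<notin> {7, 8}" "j \<notin> {7, 8}" for i j :: 8
      using exhaust_8[of i] exhaust_8[of j] that by (elim disjE; simp)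
    show "block_tangent {7, 8} N1_8_2 ?A $ i $ j $ k = w $ i $ j $ k"
      if "(i, j) \<in> ?P" "k \<in> {7, 8}" for i j k
    proof -
      have "\<forall>(i, j)\<in>?P. \<forall>k\<in>{7, 8}.
          block_tangent {7, 8} N1_8_2 ?A $ i $ j $ k = w $ i $ j $ k"
        by (simp add: block_tangent_def sum_8 N1_8_2_def from_brackets_Cons from_brackets_Nil
            basis_vec_nth)
      then show ?thesis
        using that by blast
    qed
  qed
qed

lemma N1_8_2_generic:
  "rigid_in two_step_nilpotent N1_8_2"
  "block_space {7, 8} \<subseteq> zariski closure_of (orbit N1_8_2)"
  "vec.dim (derived N1_8_2) = 2"
proof -
  \<comment> \<open>The vectors with index 7 and 8 are the brackets of the pairs (1, 2) and (3,
    4).\<close>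
  let ?\<sigma> = "\<lambda>l :: 8. if l = 7 then 1 else 3"
    and ?\<tau> = "\<lambda>l :: 8. if l = 7 then 2 else 4"
  \<comment> \<open>Each generator is matched with its partner in a defining bracket and with a
    coordinate of that bracket; \<open>?s\<close> records the sign. The values inside
    \<open>J\<close> do not matter.\<close>
  let ?\<alpha> = "\<lambda>i :: 8. if i = 1 then 2 else if i = 2 then 1 else if i = 3 then 4 else
      if i = 4 then 3 else if i = 5 then 6 else 5"
    and ?\<beta> = "\<lambda>i :: 8. if i = 3 \<or> i = 4 then 8 else 7"
    and ?s = "\<lambda>i :: 8. if i = 1 \<or> i = 3 \<or> i = 5 then 1 else -1 :: complex"
  note nth = N1_8_2_def from_brackets_Cons from_brackets_Nil
  have pairs: "N1_8_2 $ ?\<sigma> l $ ?\<tau> l = axis l 1" if "l \<in> {7, 8}" for l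
    using that by (auto simp: nth simp flip: basis_vec_def)
  have rows: "N1_8_2 $ i $ ?\<alpha> i' $ ?\<beta> i' = (if i = i' then ?s i else 0)"
    if "i \<notin> {7, 8}" "i' \<notin> {7, 8}" for i i'
    using exhaust_8[of i] exhaust_8[of i'] that by (elim disjE; simp add: nth basis_vec_nth)
  have s: "?s i \<noteq> 0" for i
    by simp
  note generic = block_space_generic[OF N1_8_2_in_block_space N1_8_2_onto pairs rows s]
  show "rigid_in two_step_nilpotent N1_8_2"
    by (rule generic(1))
  show "block_space {7, 8} \<subseteq> zariski closure_of (orbit N1_8_2)"
    by (rule generic(2))
  show "vec.dim (derived N1_8_2) = 2"
    using dim_derived_block_space[OF N1_8_2_in_block_space pairs] by simp
qed

section \<open>Three-dimensional derived algebra\<close>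

lemma N9_8_3_in_block_space: "N9_8_3 \<in> block_space {6, 7, 8}"
  unfolding N9_8_3_def by (rule from_brackets_in_block_space) (auto simp: basis_vec_nth)

lemma N9_8_3_onto:
  assumes w: "w \<in> block_space {6, 7, 8}"
  shows "\<exists>A. block_tangent {6, 7, 8} N9_8_3 A = w"
proof
  let ?A = "vec8
      (vec8 ((w $ 1 $ 2 $ 6 + 2 * w $ 1 $ 3 $ 7 + w $ 1 $ 4 $ 8 + w $ 2 $ 5 $ 7 -
        2 * w $ 2 $ 3 $ 8 - w $ 4 $ 5 $ 6) / 4) ((w $ 2 $ 3 $ 7 + w $ 2 $ 4 $ 8 +
        w $ 3 $ 4 $ 6 - w $ 1 $ 4 $ 7) / 2) (w $ 3 $ 4 $ 8 + w $ 4 $ 5 $ 7) (- w $ 3 $ 4 $ 7)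
        (- w $ 4 $ 5 $ 8) 0 0 0)
      (vec8 ((w $ 1 $ 3 $ 8 + w $ 1 $ 5 $ 7 - w $ 2 $ 5 $ 8 - w $ 3 $ 5 $ 6) / 2)
        ((w $ 1 $ 2 $ 6 + w $ 1 $ 4 $ 8 + 2 * w $ 2 $ 3 $ 8 + w $ 2 $ 5 $ 7 -
        2 * w $ 1 $ 3 $ 7 - w $ 4 $ 5 $ 6) / 4) (w $ 3 $ 5 $ 7 - w $ 4 $ 5 $ 8) (w $ 4 $ 5 $ 7)
        (- w $ 3 $ 5 $ 8) 0 0 0)
      (vec8 (w $ 2 $ 5 $ 6 + w $ 3 $ 5 $ 7 - w $ 1 $ 2 $ 8 - w $ 1 $ 3 $ 6 -
        2 * w $ 4 $ 5 $ 8) (w $ 1 $ 2 $ 7 + w $ 2 $ 3 $ 6 + w $ 3 $ 4 $ 8 + 2 * w $ 4 $ 5 $ 7 -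
        w $ 1 $ 4 $ 6) ((2 * w $ 1 $ 3 $ 7 + 2 * w $ 2 $ 3 $ 8 + w $ 4 $ 5 $ 6 - w $ 1 $ 2 $ 6 -
        w $ 1 $ 4 $ 8 - w $ 2 $ 5 $ 7) / 4) ((w $ 1 $ 4 $ 7 + w $ 2 $ 4 $ 8 - w $ 2 $ 3 $ 7 -
        w $ 3 $ 4 $ 6) / 2) ((w $ 1 $ 5 $ 7 + w $ 2 $ 5 $ 8 + w $ 3 $ 5 $ 6 -
        w $ 1 $ 3 $ 8) / 2) 0 0 0)
      (vec8 (w $ 1 $ 5 $ 6 + w $ 3 $ 5 $ 8) (w $ 2 $ 5 $ 6 + w $ 3 $ 5 $ 7 - w $ 1 $ 3 $ 6 -
        2 * w $ 4 $ 5 $ 8) (w $ 3 $ 5 $ 6) ((3 * w $ 1 $ 4 $ 8 + 2 * w $ 2 $ 3 $ 8 +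
        w $ 4 $ 5 $ 6 - w $ 1 $ 2 $ 6 - 2 * w $ 1 $ 3 $ 7 - w $ 2 $ 5 $ 7) / 4) (w $ 1 $ 5 $ 8)
        0 0 0)
      (vec8 (w $ 2 $ 3 $ 6 + w $ 3 $ 4 $ 8 + 2 * w $ 4 $ 5 $ 7 - w $ 1 $ 4 $ 6)
        (w $ 3 $ 4 $ 7 - w $ 2 $ 4 $ 6) (- w $ 3 $ 4 $ 6) (w $ 2 $ 4 $ 7) ((2 * w $ 1 $ 3 $ 7 +
        3 * w $ 2 $ 5 $ 7 + w $ 4 $ 5 $ 6 - w $ 1 $ 2 $ 6 - w $ 1 $ 4 $ 8 -
        2 * w $ 2 $ 3 $ 8) / 4) 0 0 0)
      (vec8 0 0 0 0 0 ((w $ 1 $ 2 $ 6 + w $ 4 $ 5 $ 6 - w $ 1 $ 4 $ 8 - w $ 2 $ 5 $ 7) / 2)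
        (w $ 1 $ 3 $ 6 + w $ 4 $ 5 $ 8 - w $ 3 $ 5 $ 7)
        (w $ 2 $ 3 $ 6 + w $ 3 $ 4 $ 8 + w $ 4 $ 5 $ 7))
      (vec8 0 0 0 0 0 0 0 ((w $ 1 $ 4 $ 7 + w $ 2 $ 3 $ 7 + w $ 3 $ 4 $ 6 -
        w $ 2 $ 4 $ 8) / 2))
      (vec8 0 0 0 0 0 0 ((w $ 1 $ 3 $ 8 + w $ 2 $ 5 $ 8 - w $ 1 $ 5 $ 7 - w $ 3 $ 5 $ 6) / 2)
        0)"
  let ?P = "{(1, 2), (1, 3), (1, 4), (1, 5), (2, 3), (2, 4), (2, 5), (3, 4), (3, 5), (4, 5)}"
  show "block_tangent {6, 7, 8} N9_8_3 ?A = w"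
  proof (rule block_space_eqI[where P = ?P])
    show "block_tangent {6, 7, 8} N9_8_3 ?A \<in> block_space {6, 7, 8}"
      by (rule block_tangent_in_block_space[OF N9_8_3_in_block_space])
    show "w \<in> block_space {6, 7, 8}"
      by (rule w)
    show "i = j \<or> (i, j) \<in> ?P \<or> (j, i) \<in> ?P"
      if "i \<notin> {6, 7, 8}" "j \<notin> {6, 7, 8}" for i j :: 8
      using exhaust_8[of i] exhaust_8[of j] that by (elim disjE; simp)
    show "block_tangent {6, 7, 8} N9_8_3 ?A $ i $ j $ k = w $ i $ j $ k"
      if "(i, j) \<in> ?P" "k \<in> {6, 7, 8}" for i j k
    proof -
      have "\<forall>(i, j)\<in>?P. \<forall>k\<in>{6, 7, 8}.
          block_tangent {6, 7, 8} N9_8_3 ?A $ i $ j $ k = w $ i $ j $ k"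
        by (simp add: block_tangent_def sum_8 N9_8_3_def from_brackets_Cons from_brackets_Nil
            basis_vec_nth) (intro conjI; simp add: field_simps)
      then show ?thesis
        using that by blast
    qed
  qed
qed

lemma N9_8_3_generic:
  "rigid_in two_step_nilpotent N9_8_3"
  "block_space {6, 7, 8} \<subseteq> zariski closure_of (orbit N9_8_3)"
  "vec.dim (derived N9_8_3) = 3"
proof -
  let ?\<sigma> = "\<lambda>l :: 8. if l = 8 then 2 else 1"
    and ?\<tau> = "\<lambda>l :: 8. if l = 6 then 2 else 3"
  \<comment> \<open>The vector with index 1 detects both generators 2 and 3, through coordinates 6
    and 7 respectively. Generators 1, 4 and 5 are detected by 2, 5 and 4 through coordinate
    6.\<close>
  let ?\<alpha> = "\<lambda>i :: 8. if i = 1 then 2 else if i = 4 then 5 else if i = 5 then 4 else 1"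
    and ?\<beta> = "\<lambda>i :: 8. if i = 3 then 7 else 6"
    and ?s = "\<lambda>i :: 8. if i = 1 \<or> i = 4 then 1 else -1 :: complex"
  note nth = N9_8_3_def from_brackets_Cons from_brackets_Nil
  have pairs: "N9_8_3 $ ?\<sigma> l $ ?\<tau> l = axis l 1" if "l \<in> {6, 7, 8}" for l
    using that by (auto simp: nth simp flip: basis_vec_def)
  have rows: "N9_8_3 $ i $ ?\<alpha> i' $ ?\<beta> i' = (if i = i' then ?s i else 0)"
    if "i \<notin> {6, 7, 8}" "i' \<notin> {6, 7, 8}" for i i'
    using exhaust_8[of i] exhaust_8[of i'] that by (elim disjE; simp add: nth basis_vec_nth)
  have s: "?s i \<noteq> 0" for i
    by simp
  note generic = block_space_generic[OF N9_8_3_in_block_space N9_8_3_onto pairs rows s]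
  show "rigid_in two_step_nilpotent N9_8_3"
    by (rule generic(1))
  show "block_space {6, 7, 8} \<subseteq> zariski closure_of (orbit N9_8_3)"
    by (rule generic(2))
  show "vec.dim (derived N9_8_3) = 3"
    using dim_derived_block_space[OF N9_8_3_in_block_space pairs] by simp
qed

section \<open>Four-dimensional derived algebra\<close>

lemma N1_8_4_in_block_space: "N1_8_4 \<in> block_space {5, 6, 7, 8}"
  unfolding N1_8_4_def by (rule from_brackets_in_block_space) (auto simp: basis_vec_nth)

lemma N1_8_4_onto:
  assumes w: "w \<in> block_space {5, 6, 7, 8}"
  shows "\<exists>A. block_tangent {5, 6, 7, 8} N1_8_4 A = w"
proof
  let ?A = "vec8
      (vec8 (- w $ 1 $ 4 $ 8) (- w $ 2 $ 4 $ 8) (- w $ 3 $ 4 $ 8) (- w $ 2 $ 4 $ 5) 0 0 0 0)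
      (vec8 (w $ 1 $ 3 $ 6) (w $ 2 $ 3 $ 6 - w $ 3 $ 4 $ 7) (w $ 1 $ 3 $ 5) (- w $ 3 $ 4 $ 6)
        0 0 0 0)
      (vec8 (w $ 1 $ 4 $ 7) (w $ 2 $ 4 $ 7) (w $ 3 $ 4 $ 7) (w $ 2 $ 4 $ 6) 0 0 0 0)
      (vec8 (- w $ 1 $ 3 $ 7) (- w $ 1 $ 2 $ 8) (- w $ 1 $ 3 $ 8) 0 0 0 0 0)
      (vec8 0 0 0 0 (w $ 1 $ 2 $ 5 + w $ 1 $ 4 $ 8 + w $ 3 $ 4 $ 7 - w $ 2 $ 3 $ 6)
        (w $ 2 $ 3 $ 5 - w $ 3 $ 4 $ 8) (w $ 3 $ 4 $ 5) (- w $ 1 $ 4 $ 5 - w $ 3 $ 4 $ 6))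
      (vec8 0 0 0 0 (w $ 1 $ 2 $ 6 + w $ 1 $ 4 $ 7) 0 0 (- w $ 1 $ 4 $ 6))
      (vec8 0 0 0 0 (w $ 1 $ 2 $ 7) (w $ 2 $ 3 $ 7 - w $ 1 $ 2 $ 8) 0 0)
      (vec8 0 0 0 0 0 (w $ 2 $ 3 $ 8) 0 0)"
  let ?P = "{(1, 2), (1, 3), (1, 4), (2, 3), (2, 4), (3, 4)}"
  show "block_tangent {5, 6, 7, 8} N1_8_4 ?A = w"
  proof (rule block_space_eqI[where P = ?P])
    show "block_tangent {5, 6, 7, 8} N1_8_4 ?A \<in> block_space {5, 6, 7, 8}"
      by (rule block_tangent_in_block_space[OF N1_8_4_in_block_space])
    show "w \<in> block_space {5, 6, 7, 8}"
      by (rule w)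
    show "i = j \<or> (i, j) \<in> ?P \<or> (j, i) \<in> ?P"
      if "i \<notin> {5, 6, 7, 8}" "j \<notin> {5, 6, 7, 8}" for i j :: 8
      using exhaust_8[of i] exhaust_8[of j] that by (elim disjE; simp)
    show "block_tangent {5, 6, 7, 8} N1_8_4 ?A $ i $ j $ k = w $ i $ j $ k"
      if "(i, j) \<in> ?P" "k \<in> {5, 6, 7, 8}" for i j k
    proof -
      have "\<forall>(i, j)\<in>?P. \<forall>k\<in>{5, 6, 7, 8}.
          block_tangent {5, 6, 7, 8} N1_8_4 ?A $ i $ j $ k = w $ i $ j $ k"
        by (simp add: block_tangent_def sum_8 N1_8_4_def from_brackets_Cons from_brackets_Nil
            basis_vec_nth)
      then show ?thesis
        using that by blast
    qed
  qed
qed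

lemma N1_8_4_generic:
  "rigid_in two_step_nilpotent N1_8_4"
  "block_space {5, 6, 7, 8} \<subseteq> zariski closure_of (orbit N1_8_4)"
  "vec.dim (derived N1_8_4) = 4"
proof -
  let ?\<sigma> = "\<lambda>l :: 8. if l = 5 then 1 else if l = 6 then 2 else if l = 7 then 3 else 4"
    and ?\<tau> = "\<lambda>l :: 8. if l = 5 then 2 else if l = 6 then 3 else if l = 7 then 4 else 1"
  \<comment> \<open>The two disjoint brackets of (1, 2) and (3, 4) suffice to detect all four
    generators.\<close>
  let ?\<alpha> = "\<lambda>i :: 8. if i = 1 then 2 else if i = 2 then 1 else if i = 3 then 4 else 3"
    and ?\<beta> = "\<lambda>i :: 8. if i = 1 \<or> i = 2 then 5 else 7"
    and ?s = "\<lambda>i :: 8. if i = 1 \<or> i = 3 then 1 else -1 :: complex"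
  note nth = N1_8_4_def from_brackets_Cons from_brackets_Nil
  have pairs: "N1_8_4 $ ?\<sigma> l $ ?\<tau> l = axis l 1" if "l \<in> {5, 6, 7, 8}" for l
    using that by (auto simp: nth simp flip: basis_vec_def)
  have rows: "N1_8_4 $ i $ ?\<alpha> i' $ ?\<beta> i' = (if i = i' then ?s i else 0)"
    if "i \<notin> {5, 6, 7, 8}" "i' \<notin> {5, 6, 7, 8}" for i i'
    using exhaust_8[of i] exhaust_8[of i'] that by (elim disjE; simp add: nth basis_vec_nth)
  have s: "?s i \<noteq> 0" for i
    by simp
  note generic = block_space_generic[OF N1_8_4_in_block_space N1_8_4_onto pairs rows s]
  show "rigid_in two_step_nilpotent N1_8_4"
    by (rule generic(1))
  show "block_space {5, 6, 7, 8} \<subseteq> zariski closure_of (orbit N1_8_4)"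
    by (rule generic(2))
  show "vec.dim (derived N1_8_4) = 4"
    using dim_derived_block_space[OF N1_8_4_in_block_space pairs] by simp
qed

section \<open>The irreducible components\<close>

lemma in_block_space_8:
  fixes c :: "8 structure_constants"
  assumes c: "c \<in> two_step_nilpotent"
  obtains g J where "invertible g" "change_basis g c \<in> block_space J"
    "J = {7, 8} \<or> J = {6, 7, 8} \<or> J = {5, 6, 7, 8}"
proof -
  let ?d = "vec.dim (derived c)" and ?z = "vec.dim (center c)"
  have "?d \<le> ?z"
    by (intro vec.dim_subset derived_subset_center c)
  moreover have "2 \<le> ?z"
    by (rule dim_center_ge_2[OF c]) simp
  moreover have "?d \<le> 3" if "5 \<le> ?z"
    by (rule dim_derived_le_3[OF c]) (use that in simp)
  \<comment> \<open>A derived algebra of dimension at least 5 would force a centre of dimension at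
    least 5, and then the derived algebra has dimension at most 3. So the dimension is at most 4,
    and it or 2, whichever is larger, fits below that of the centre.\<close>
  ultimately consider "?d \<le> 2" "2 \<le> ?z" | "?d \<le> 3" "3 \<le> ?z" | "?d \<le> 4" "4 \<le> ?z"
    by linarith
  then have "\<exists>J :: 8 set. ?d \<le> card J \<and> card J \<le> ?z \<and>
      (J = {7, 8} \<or> J = {6, 7, 8} \<or> J = {5, 6, 7, 8})"
  proof cases
    case 1
    then show ?thesis
      by (intro exI[of _ "{7, 8}"]) simp
  next
    case 2
    then show ?thesis
      by (intro exI[of _ "{6, 7, 8}"]) simp
  next
    case 3
    then show ?thesis
      by (intro exI[of _ "{5, 6, 7, 8}"]) simp
  qed
  then obtain J :: "8 set" where J: "?d \<le> card J" "card J \<le> ?z"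
    "J = {7, 8} \<or> J = {6, 7, 8} \<or> J = {5, 6, 7, 8}"
    by blast
  obtain g where "invertible g" "change_basis g c \<in> block_space J"
    by (rule block_space_representative[OF c J(1,2)])
  then show thesis
    using J(3) by (rule that)
qed

theorem theorem3p1:
  shows "irreducible_components (subtopology zariski (two_step_nilpotent :: 8 structure_constants set))
           = {zariski closure_of (orbit N1_8_2),
              zariski closure_of (orbit N9_8_3),
              zariski closure_of (orbit N1_8_4)}
       \<and> distinct [zariski closure_of (orbit N1_8_2),
                   zariski closure_of (orbit N9_8_3),
                   zariski closure_of (orbit N1_8_4)]
       \<and> rigid_in two_step_nilpotent N1_8_2
       \<and> rigid_in two_step_nilpotent N9_8_3
       \<and> rigid_in two_step_nilpotent N1_8_4"
proof -
  let ?S = "{N1_8_2, N9_8_3, N1_8_4}"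
  let ?N = "two_step_nilpotent :: 8 structure_constants set"
  let ?C = "\<lambda>a :: 8 structure_constants. zariski closure_of (orbit a)"
  have rigid: "rigid_in ?N a" if "a \<in> ?S" for a
    using that N1_8_2_generic(1) N9_8_3_generic(1) N1_8_4_generic(1) by auto
  have orbit_sub: "orbit a \<subseteq> ?N" if "a \<in> ?S" for a
    using rigid[OF that] by (intro orbit_subset_two_step_nilpotent) (simp add: rigid_in_def)
  have closure_sub: "?C a \<subseteq> ?N" if "a \<in> ?S" for a
    by (intro closure_of_minimal orbit_sub that)
      (simp add: closedin_zariski algebraic_set_two_step_nilpotent)
  \<comment> \<open>Inclusion of closures forces equality of the orbits by rigidity, and the
    dimensions 2, 3 and 4 of the derived algebras tell the structures apart.\<close>
  have antichain: "a = b" if "a \<in> ?S" "b \<in> ?S" "?C a \<subseteq> ?C b" for a b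
  proof -
    have "a \<in> orbit b"
      using rigid_orbit_closure_subset[OF rigid[OF that(1)] orbit_sub[OF that(2)] that(3)]
        orbit_refl[of a] by simp
    then have "vec.dim (derived a) = vec.dim (derived b)"
      by (rule dim_derived_orbit)
    then show ?thesis
      using that(1,2) N1_8_2_generic(3) N9_8_3_generic(3) N1_8_4_generic(3) by auto
  qed
  have cover: "?N \<subseteq> \<Union>(?C ` ?S)"
  proof
    fix c assume "c \<in> ?N"
    then obtain g J where g: "invertible g" "change_basis g c \<in> block_space J"
      and J: "J = {7, 8} \<or> J = {6, 7, 8} \<or> J = {5, 6, 7, 8}"
      by (rule in_block_space_8)
    have "\<exists>a\<in>?S. block_space J \<subseteq> ?C a"
      using J N1_8_2_generic(2) N9_8_3_generic(2) N1_8_4_generic(2) by blast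
    then obtain a where a: "a \<in> ?S" "change_basis g c \<in> ?C a"
      using g(2) by blast
    \<comment> \<open>The orbit closure is invariant, so membership is carried back from the block
      representative to \<open>c\<close>.\<close>
    have "change_basis (matrix_inv g) (change_basis g c) \<in> ?C a"
      by (intro closure_of_orbit_invariant invertible_matrix_inv g(1) a(2))
    then show "c \<in> \<Union>(?C ` ?S)"
      using a(1) by (auto simp only: change_basis_matrix_inv(1)[OF g(1)])
  qed
  have "irreducible_components (subtopology zariski ?N) = ?C ` ?S"
  proof (rule irreducible_components_eqI)
    show "topspace (subtopology zariski ?N) \<subseteq> \<Union>(?C ` ?S)"
      using cover by simp
    show "closedin (subtopology zariski ?N) C" if "C \<in> ?C ` ?S" for C
      using that closure_sub by (auto intro!: closedin_subset_topspace)
    show "irreducible_in (subtopology zariski ?N) C" if C: "C \<in> ?C ` ?S" for C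
    proof -
      obtain a where a: "a \<in> ?S" "C = ?C a"
        using C by blast
      show ?thesis
        unfolding a(2)
        by (rule irreducible_in_subtopology[OF irreducible_in_closure_of[OF irreducible_in_orbit]
              closure_sub[OF a(1)]])
    qed
    show "C = D" if CD: "C \<in> ?C ` ?S" "D \<in> ?C ` ?S" "C \<subseteq> D" for C D
    proof -
      obtain a where a: "a \<in> ?S" "C = ?C a"
        using CD(1) by blast
      obtain b where b: "b \<in> ?S" "D = ?C b"
        using CD(2) by blast
      have "a = b"
        using CD(3) unfolding a(2) b(2) by (rule antichain[OF a(1) b(1)])
      then show ?thesis
        by (simp only: a(2) b(2))
    qed
  qed simp
  moreover have "N1_8_2 \<noteq> N9_8_3" "N1_8_2 \<noteq> N1_8_4" "N9_8_3 \<noteq> N1_8_4"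
    using N1_8_2_generic(3) N9_8_3_generic(3) N1_8_4_generic(3) by auto
  then have "?C N1_8_2 \<noteq> ?C N9_8_3" "?C N1_8_2 \<noteq> ?C N1_8_4" "?C N9_8_3 \<noteq> ?C N1_8_4"
    using antichain[of N1_8_2 N9_8_3] antichain[of N1_8_2 N1_8_4] antichain[of N9_8_3 N1_8_4]
    by auto
  ultimately show ?thesis
    using rigid by simp
qed

end
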